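(* Consider a combinatorial problem given by ground sets $\mathcal{U}$ of size $n$ and feasible families $\mathcal{F}\subseteq 2^{\mathcal{U}}$ (with polynomial-time membership test). If there is a polynomial-time $\alpha$-approximation algorithm ($\alpha\ge 1$) for the min-sum problem $\min_{S\in\mathcal{F}}\sum_{e\in S}v_e$ (for arbitrary nonnegative values $v$), then for any fixed constant $\epsilon>0$ there is a polynomial-time $(4\alpha\lceil\log n\rceil+\epsilon)$-approximation algorithm for the corresponding MinNorm problem.
   Context: MinNorm: given $\mathcal{U}$, $\mathcal{F}$, a value vector $\boldsymbol{v}\in\mathbb{R}_{\ge0}^{\mathcal{U}}$ and a symmetric monotone norm $f:\mathbb{R}^n\to\mathbb{R}_+$, find $S\in\mathcal{F}$ minimizing $f(\boldsymbol{v}[S])$, where $\boldsymbol{v}[S]$ has entries $v_e\mathbf{1}[e\in S]$. A norm is monotone if $f(v)\le f(u)$ for $0\le v\le u$ and symmetric if invariant under coordinate permutations. $\log$ is base 2.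
   Formalization: Ground sets are assumed to have size n ≥ 2: for n = 1 the ratio is ε, which is unattainable for ε < 1 (take 𝓕 = {𝓤}). Polynomial time is measured on a real RAM, with f given by a value oracle. *)

theory Defs
  imports
    Complex_Main
    "HOL-Computational_Algebra.Polynomial"
    "HOL-Combinatorics.Permutations"
begin

section \<open>Symmetric monotone norms on varying dimensions\<close>

text \<open>
  The dimension \<open>n\<close> is part of the input, so a vector of \<open>\<real>\<^sup>n\<close> is a function on the naturals
  that vanishes outside \<open>{..<n}\<close>.
\<close>

definition vecs :: "nat \<Rightarrow> (nat \<Rightarrow> real) set" where
  "vecs n = {x. \<forall>i\<ge>n. x i = 0}"

definition nonneg_vecs :: "nat \<Rightarrow> (nat \<Rightarrow> real) set" where
  "nonneg_vecs n = {x \<in> vecs n. \<forall>i. 0 \<le> x i}"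

definition is_norm :: "nat \<Rightarrow> ((nat \<Rightarrow> real) \<Rightarrow> real) \<Rightarrow> bool" where
  "is_norm n f \<longleftrightarrow>
     (\<forall>x\<in>vecs n. 0 \<le> f x) \<and>
     (\<forall>x\<in>vecs n. f x = 0 \<longleftrightarrow> (\<forall>i. x i = 0)) \<and>
     (\<forall>c. \<forall>x\<in>vecs n. f (\<lambda>i. c * x i) = \<bar>c\<bar> * f x) \<and>
     (\<forall>x\<in>vecs n. \<forall>y\<in>vecs n. f (\<lambda>i. x i + y i) \<le> f x + f y)"

definition monotone_norm :: "nat \<Rightarrow> ((nat \<Rightarrow> real) \<Rightarrow> real) \<Rightarrow> bool" where
  "monotone_norm n f \<longleftrightarrow>
     is_norm n f \<and>
     (\<forall>x\<in>nonneg_vecs n. \<forall>y\<in>nonneg_vecs n. (\<forall>i. x i \<le> y i) \<longrightarrow> f x \<le> f y)"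

definition symmetric_norm :: "nat \<Rightarrow> ((nat \<Rightarrow> real) \<Rightarrow> real) \<Rightarrow> bool" where
  "symmetric_norm n f \<longleftrightarrow>
     is_norm n f \<and> (\<forall>\<pi>. \<pi> permutes {..<n} \<longrightarrow> (\<forall>x\<in>vecs n. f (x \<circ> \<pi>) = f x))"

definition restrict_vec :: "(nat \<Rightarrow> real) \<Rightarrow> nat set \<Rightarrow> nat \<Rightarrow> real" where
  "restrict_vec v S = (\<lambda>e. if e \<in> S then v e else 0)"


section \<open>A real RAM with an oracle\<close>

text \<open>
  Values and norms are real, so running times are measured on a real RAM: every program is one
  fixed finite text, used for all inputs, and exact arithmetic and comparison of reals cost one
  step. There are finitely many index registers holding naturals and finitely many arrays of
  reals (those named in the text); arrays are indexed by naturals. Index registers have no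
  multiplication and there is no rounding of reals to integers, so unit cost gives no hidden power
  to manipulate long bit strings. The only constants are integers; division by zero yields zero.
\<close>

datatype iexp =
    IConst nat
  | IVar nat
  | IAdd iexp iexp
  | ISub iexp iexp

datatype rexp =
    RConst int
  | RIdx iexp
  | RCell nat iexp
  | RAdd rexp rexp
  | RSub rexp rexp
  | RMul rexp rexp
  | RDiv rexp rexp

datatype bexp =
    ILess iexp iexp
  | RLess rexp rexp
  | BNot bexp
  | BAnd bexp bexp

text \<open>
  \<open>Fresh a\<close> binds \<open>a\<close> to a new all-zero array. \<open>Query a i b\<close> writes the oracle's answer on the
  contents of \<open>b\<close> into cell \<open>i\<close> of \<open>a\<close>.
\<close>

datatype com =
    Skip
  | SetIdx nat iexp
  | SetCell nat iexp rexp
  | Fresh nat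
  | Query nat iexp nat
  | Seq com com
  | Cond bexp com com
  | Loop bexp com

record ram_state =
  idx :: "nat \<Rightarrow> nat"
  arr :: "nat \<Rightarrow> nat \<Rightarrow> real"

primrec ival :: "iexp \<Rightarrow> ram_state \<Rightarrow> nat" where
  "ival (IConst k) s = k"
| "ival (IVar i) s = idx s i"
| "ival (IAdd a b) s = ival a s + ival b s"
| "ival (ISub a b) s = ival a s - ival b s"

primrec rval :: "rexp \<Rightarrow> ram_state \<Rightarrow> real" where
  "rval (RConst k) s = of_int k"
| "rval (RIdx a) s = real (ival a s)"
| "rval (RCell a i) s = arr s a (ival i s)"
| "rval (RAdd a b) s = rval a s + rval b s"
| "rval (RSub a b) s = rval a s - rval b s"
| "rval (RMul a b) s = rval a s * rval b s"
| "rval (RDiv a b) s = rval a s / rval b s"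

primrec bval :: "bexp \<Rightarrow> ram_state \<Rightarrow> bool" where
  "bval (ILess a b) s \<longleftrightarrow> ival a s < ival b s"
| "bval (RLess a b) s \<longleftrightarrow> rval a s < rval b s"
| "bval (BNot b) s \<longleftrightarrow> \<not> bval b s"
| "bval (BAnd b c) s \<longleftrightarrow> bval b s \<and> bval c s"

definition set_idx :: "nat \<Rightarrow> nat \<Rightarrow> ram_state \<Rightarrow> ram_state" where
  "set_idx i k s = s\<lparr>idx := (idx s)(i := k)\<rparr>"

definition set_arr :: "nat \<Rightarrow> (nat \<Rightarrow> real) \<Rightarrow> ram_state \<Rightarrow> ram_state" where
  "set_arr a x s = s\<lparr>arr := (arr s)(a := x)\<rparr>"

definition set_cell :: "nat \<Rightarrow> nat \<Rightarrow> real \<Rightarrow> ram_state \<Rightarrow> ram_state" where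
  "set_cell a i r s = set_arr a ((arr s a)(i := r)) s"

text \<open>
  \<open>exec orc c s t s'\<close>: started in \<open>s\<close>, the program \<open>c\<close> halts after \<open>t\<close> steps in \<open>s'\<close>. The
  expressions in a fixed program have bounded size, so evaluating one is charged a single step.
\<close>

inductive exec ::
  "((nat \<Rightarrow> real) \<Rightarrow> real) \<Rightarrow> com \<Rightarrow> ram_state \<Rightarrow> nat \<Rightarrow> ram_state \<Rightarrow> bool"
  for orc :: "(nat \<Rightarrow> real) \<Rightarrow> real" where
  exec_Skip: "exec orc Skip s 1 s"
| exec_SetIdx: "exec orc (SetIdx i e) s 1 (set_idx i (ival e s) s)"
| exec_SetCell: "exec orc (SetCell a i e) s 1 (set_cell a (ival i s) (rval e s) s)"
| exec_Fresh: "exec orc (Fresh a) s 1 (set_arr a (\<lambda>_. 0) s)"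
| exec_Query: "exec orc (Query a i b) s 1 (set_cell a (ival i s) (orc (arr s b)) s)"
| exec_Seq: "exec orc c s t s' \<Longrightarrow> exec orc d s' u s'' \<Longrightarrow> exec orc (Seq c d) s (t + u) s''"
| exec_CondT: "bval b s \<Longrightarrow> exec orc c s t s' \<Longrightarrow> exec orc (Cond b c d) s (t + 1) s'"
| exec_CondF: "\<not> bval b s \<Longrightarrow> exec orc d s t s' \<Longrightarrow> exec orc (Cond b c d) s (t + 1) s'"
| exec_LoopF: "\<not> bval b s \<Longrightarrow> exec orc (Loop b c) s 1 s"
| exec_LoopT: "bval b s \<Longrightarrow> exec orc c s t s' \<Longrightarrow> exec orc (Loop b c) s' u s'' \<Longrightarrow>
    exec orc (Loop b c) s (t + u + 1) s''"

lemma exec_deterministic: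
  assumes "exec orc c s t s'" and "exec orc c s u s''"
  shows "t = u \<and> s' = s''"
  using assms
proof (induction arbitrary: u s'' rule: exec.induct)
  case (exec_Seq c s t s' d u s'')
  from exec_Seq.prems show ?case
    by (cases rule: exec.cases) (use exec_Seq.IH in blast)+
next
  case (exec_LoopT b s c t s' u s'')
  from exec_LoopT.prems show ?case
    by (cases rule: exec.cases) (use exec_LoopT.hyps exec_LoopT.IH in blast)+
next
  case (exec_CondT b s c t s' d)
  from exec_CondT.prems show ?case
    by (cases rule: exec.cases) (use exec_CondT.hyps exec_CondT.IH in blast)+
next
  case (exec_CondF b s d t s' c)
  from exec_CondF.prems show ?case
    by (cases rule: exec.cases) (use exec_CondF.hyps exec_CondF.IH in blast)+
qed (erule exec.cases; simp)+

primrec oracle_free :: "com \<Rightarrow> bool" where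
  "oracle_free Skip \<longleftrightarrow> True"
| "oracle_free (SetIdx i e) \<longleftrightarrow> True"
| "oracle_free (SetCell a i e) \<longleftrightarrow> True"
| "oracle_free (Fresh a) \<longleftrightarrow> True"
| "oracle_free (Query a i b) \<longleftrightarrow> False"
| "oracle_free (Seq c d) \<longleftrightarrow> oracle_free c \<and> oracle_free d"
| "oracle_free (Cond b c d) \<longleftrightarrow> oracle_free c \<and> oracle_free d"
| "oracle_free (Loop b c) \<longleftrightarrow> oracle_free c"

text \<open>
  Input convention: array 0 and index register 0 hold the description of the instance and its
  length, array 1 and index register 1 a vector of \<open>\<real>\<^sup>n\<close> and its dimension \<open>n\<close>; everything else
  is zero. A set of elements is returned as the support of array 2, a yes/no answer in index
  register 2.
\<close>

definition input :: "real list \<Rightarrow> nat \<Rightarrow> (nat \<Rightarrow> real) \<Rightarrow> ram_state" where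
  "input x n v =
     \<lparr>idx = (\<lambda>_. 0)(0 := length x, 1 := n),
      arr = (\<lambda>_ _. 0)(0 := (\<lambda>i. if i < length x then x ! i else 0), 1 := v)\<rparr>"

definition out_set :: "nat \<Rightarrow> ram_state \<Rightarrow> nat set" where
  "out_set n s = {i. i < n \<and> arr s 2 i \<noteq> 0}"

definition out_bool :: "ram_state \<Rightarrow> bool" where
  "out_bool s \<longleftrightarrow> idx s 2 \<noteq> 0"

definition no_oracle :: "(nat \<Rightarrow> real) \<Rightarrow> real" where
  "no_oracle = (\<lambda>_. 0)"

text \<open>The value oracle of \<open>f\<close> reads the first \<open>n\<close> cells of the queried array.\<close>

definition value_oracle :: "nat \<Rightarrow> ((nat \<Rightarrow> real) \<Rightarrow> real) \<Rightarrow> (nat \<Rightarrow> real) \<Rightarrow> real" where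
  "value_oracle n f = (\<lambda>x. f (restrict_vec x {..<n}))"


section \<open>Combinatorial problems and approximation algorithms\<close>

text \<open>
  A problem is a family of instances, each given by a finite description. The elements of the
  ground set of \<open>x\<close> are numbered \<open>0, \<dots>, n - 1\<close> where \<open>n = gsize P x\<close>.
\<close>

record comb_problem =
  instances :: "real list set"
  gsize :: "real list \<Rightarrow> nat"
  feasible :: "real list \<Rightarrow> nat set set"

definition comb_problem :: "comb_problem \<Rightarrow> bool" where
  "comb_problem P \<longleftrightarrow> (\<forall>x\<in>instances P. feasible P x \<subseteq> Pow {..<gsize P x})"

definition input_size :: "comb_problem \<Rightarrow> real list \<Rightarrow> nat" where
  "input_size P x = length x + gsize P x"

definition poly_time_membership_test :: "comb_problem \<Rightarrow> com \<Rightarrow> bool" where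
  "poly_time_membership_test P D \<longleftrightarrow> oracle_free D \<and>
     (\<exists>p :: nat poly. \<forall>x\<in>instances P. \<forall>S. S \<subseteq> {..<gsize P x} \<longrightarrow>
        (\<exists>t s'. exec no_oracle D (input x (gsize P x) (\<lambda>i. if i \<in> S then 1 else 0)) t s' \<and>
           t \<le> poly p (input_size P x) \<and>
           (out_bool s' \<longleftrightarrow> S \<in> feasible P x)))"

definition approx_minimizer :: "nat set set \<Rightarrow> (nat set \<Rightarrow> real) \<Rightarrow> real \<Rightarrow> nat set \<Rightarrow> bool" where
  "approx_minimizer F cost r S \<longleftrightarrow> S \<in> F \<and> (\<forall>T\<in>F. cost S \<le> r * cost T)"

text \<open>
  The ratio may depend on \<open>n\<close>. An instance without feasible sets has no minimum; there the
  algorithms are only required to halt within the time bound.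
\<close>

definition poly_time_min_sum_approx :: "comb_problem \<Rightarrow> (nat \<Rightarrow> real) \<Rightarrow> com \<Rightarrow> bool" where
  "poly_time_min_sum_approx P r A \<longleftrightarrow> oracle_free A \<and>
     (\<exists>p :: nat poly. \<forall>x\<in>instances P. \<forall>v\<in>nonneg_vecs (gsize P x).
        (\<exists>t s'. exec no_oracle A (input x (gsize P x) v) t s' \<and>
           t \<le> poly p (input_size P x) \<and>
           (feasible P x \<noteq> {} \<longrightarrow>
              approx_minimizer (feasible P x) (\<lambda>S. \<Sum>e\<in>S. v e) (r (gsize P x))
                (out_set (gsize P x) s'))))"

definition poly_time_min_norm_approx :: "comb_problem \<Rightarrow> (nat \<Rightarrow> real) \<Rightarrow> com \<Rightarrow> bool" where
  "poly_time_min_norm_approx P r B \<longleftrightarrow>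
     (\<exists>p :: nat poly. \<forall>x\<in>instances P. \<forall>v\<in>nonneg_vecs (gsize P x). \<forall>f.
        symmetric_norm (gsize P x) f \<and> monotone_norm (gsize P x) f \<longrightarrow>
        (\<exists>t s'. exec (value_oracle (gsize P x) f) B (input x (gsize P x) v) t s' \<and>
           t \<le> poly p (input_size P x) \<and>
           (feasible P x \<noteq> {} \<longrightarrow>
              approx_minimizer (feasible P x) (\<lambda>S. f (restrict_vec v S)) (r (gsize P x))
                (out_set (gsize P x) s'))))"

end

theory Submission imports Defs begin

text \<open>
  Put \<open>\<phi> k = f (1, \<dots>, 1, 0, \<dots>, 0)\<close> with \<open>k\<close> ones and \<open>m = \<lceil>log n\<rceil>\<close>. If \<open>\<tau>\<close> is the optimal value,
  then fewer than \<open>2^i\<close> elements \<open>e\<close> of an optimal set satisfy \<open>v e * \<phi> (2^i) > \<tau>\<close>. Charging an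
  element \<open>2 \<tau> / 2^i\<close> for every level \<open>i \<le> m\<close> with \<open>v e * \<phi> (2^i) > \<tau>\<close> makes the total charge of an
  optimal set at most \<open>2 m \<tau>\<close>. Conversely the elements of a set that are above \<open>\<tau>\<close> at level \<open>i + 1\<close>
  but not at level \<open>i\<close> can be cut into blocks of size \<open>2^i\<close>, each of norm at most \<open>\<tau>\<close>, so the norm
  of any set is at most its charge plus \<open>(m + 1) \<tau>\<close>. A min-sum approximation for the charges hence
  has norm at most \<open>(2 \<alpha> m + m + 1) \<tau> \<le> 4 \<alpha> m \<tau>\<close>. The only property of \<open>\<tau>\<close> that matters
  is how it compares with the numbers \<open>v e * \<phi> (2^i)\<close>, so it suffices to try these numbers for
  \<open>\<tau>\<close> and to keep the best of the resulting sets.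
\<close>

section \<open>Dyadic thresholds for a symmetric monotone norm\<close>

abbreviation ones :: "nat set \<Rightarrow> nat \<Rightarrow> real" where
  "ones \<equiv> restrict_vec (\<lambda>_. 1)"

lemma restrict_vec_nonneg:
  assumes "C \<subseteq> {..<n}" "\<And>e. e \<in> C \<Longrightarrow> 0 \<le> v e"
  shows "restrict_vec v C \<in> nonneg_vecs n"
  using assms by (auto simp: restrict_vec_def nonneg_vecs_def vecs_def)

lemma nonneg_vecs_vecs: "x \<in> nonneg_vecs n \<Longrightarrow> x \<in> vecs n"
  by (simp add: nonneg_vecs_def)

text \<open>A bijection from \<open>{..<card C}\<close> to \<open>C\<close> is glued to one between
  the complements, which have equal size. Through symmetry this makes the norm of an indicator
  vector depend on the cardinality alone.\<close>

lemma permutes_initial_segment: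
  assumes "C \<subseteq> {..<n::nat}"
  obtains \<pi> where "\<pi> permutes {..<n}" "\<And>i. \<pi> i \<in> C \<longleftrightarrow> i < card C"
proof -
  have fin: "finite C" using assms finite_subset by blast
  have le: "card C \<le> n" using card_mono[OF _ assms] by simp
  obtain g where g: "bij_betw g {..<card C} C"
    using fin by (metis bij_betw_iff_card card_lessThan finite_lessThan)
  have "card {card C..<n} = card ({..<n} - C)"
    using assms fin by (simp add: card_Diff_subset)
  then obtain h where h: "bij_betw h {card C..<n} ({..<n} - C)"
    by (metis bij_betw_iff_card finite_Diff finite_atLeastLessThan finite_lessThan)
  define \<pi> where "\<pi> i = (if i < card C then g i else if i < n then h i else i)" for i
  have 1: "bij_betw \<pi> {..<card C} C"
    using g by (rule bij_betw_cong[THEN iffD1, rotated]) (simp add: \<pi>_def)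
  have 2: "bij_betw \<pi> {card C..<n} ({..<n} - C)"
    using h by (rule bij_betw_cong[THEN iffD1, rotated]) (simp add: \<pi>_def)
  have "bij_betw \<pi> ({..<card C} \<union> {card C..<n}) (C \<union> ({..<n} - C))"
    using 1 2 by (rule bij_betw_combine) auto
  moreover have "{..<card C} \<union> {card C..<n} = {..<n}" "C \<union> ({..<n} - C) = {..<n}"
    using le assms by auto
  ultimately have "bij_betw \<pi> {..<n} {..<n}" by simp
  then have "\<pi> permutes {..<n}"
    by (rule bij_imp_permutes) (use le in \<open>auto simp: \<pi>_def\<close>)
  moreover have "\<pi> i \<in> C \<longleftrightarrow> i < card C" for i
  proof (cases "i < card C")
    case True
    then show ?thesis using bij_betwE[OF 1] by auto
  next
    case False
    show ?thesis
    proof (cases "i < n")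
      case True
      then show ?thesis using False bij_betwE[OF 2] by auto
    next
      case False
      then show ?thesis using le assms by (auto simp: \<pi>_def)
    qed
  qed
  ultimately show thesis by (rule that)
qed

locale sym_mono_norm =
  fixes n :: nat and f :: "(nat \<Rightarrow> real) \<Rightarrow> real"
  assumes sym: "symmetric_norm n f" and mono: "monotone_norm n f"
begin

lemma norm_nonneg: "x \<in> vecs n \<Longrightarrow> 0 \<le> f x"
  using sym by (auto simp: symmetric_norm_def is_norm_def)

lemma norm_eq_0: "x \<in> vecs n \<Longrightarrow> f x = 0 \<Longrightarrow> x i = 0"
  using sym by (auto simp: symmetric_norm_def is_norm_def)

lemma norm_scale: "x \<in> vecs n \<Longrightarrow> f (\<lambda>i. c * x i) = \<bar>c\<bar> * f x"
  using sym by (auto simp: symmetric_norm_def is_norm_def)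

lemma norm_triangle: "x \<in> vecs n \<Longrightarrow> y \<in> vecs n \<Longrightarrow> f (\<lambda>i. x i + y i) \<le> f x + f y"
  using sym by (auto simp: symmetric_norm_def is_norm_def)

lemma norm_mono:
  "x \<in> nonneg_vecs n \<Longrightarrow> y \<in> nonneg_vecs n \<Longrightarrow> (\<And>i. x i \<le> y i) \<Longrightarrow> f x \<le> f y"
  using mono by (auto simp: monotone_norm_def)

lemma norm_permute: "\<pi> permutes {..<n} \<Longrightarrow> x \<in> vecs n \<Longrightarrow> f (x \<circ> \<pi>) = f x"
  using sym by (auto simp: symmetric_norm_def)

section \<open>Norms of indicator vectors\<close>

lemma ones_vecs: "C \<subseteq> {..<n} \<Longrightarrow> ones C \<in> nonneg_vecs n"
  by (rule restrict_vec_nonneg) auto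

lemma norm_ones_card:
  assumes "C \<subseteq> {..<n}"
  shows "f (ones C) = f (ones {..<card C})"
proof -
  obtain \<pi> where \<pi>: "\<pi> permutes {..<n}" "\<And>i. \<pi> i \<in> C \<longleftrightarrow> i < card C"
    using permutes_initial_segment[OF assms] by blast
  have "ones C \<circ> \<pi> = ones {..<card C}"
    by (rule ext) (simp add: restrict_vec_def \<pi>(2))
  then show ?thesis
    using norm_permute[OF \<pi>(1) nonneg_vecs_vecs[OF ones_vecs[OF assms]]] by simp
qed

text \<open>The cap at \<open>n\<close> gives a value also to powers of two beyond the dimension,
  and it is what the value oracle returns on a run of \<open>k\<close> ones, since the oracle cuts
  its argument at \<open>n\<close>.\<close>

definition phi :: "nat \<Rightarrow> real" where
  "phi k = f (ones {..<min k n})"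

lemma phi_mono: "k \<le> l \<Longrightarrow> phi k \<le> phi l"
  unfolding phi_def by (rule norm_mono[OF ones_vecs ones_vecs]) (auto simp: restrict_vec_def)

lemma phi_nonneg: "0 \<le> phi k"
  unfolding phi_def by (intro norm_nonneg nonneg_vecs_vecs ones_vecs) auto

lemma phi_pos:
  assumes "0 < n" "0 < k"
  shows "0 < phi k"
proof -
  have "ones {..<min k n} \<in> vecs n" by (intro nonneg_vecs_vecs ones_vecs) auto
  then have "phi k \<noteq> 0"
    using norm_eq_0[of "ones {..<min k n}" 0] assms by (auto simp: phi_def restrict_vec_def)
  then show ?thesis using phi_nonneg[of k] by linarith
qed

lemma norm_ones: "C \<subseteq> {..<n} \<Longrightarrow> f (ones C) = phi (card C)"
  using norm_ones_card[of C] card_mono[of "{..<n}" C] by (simp add: phi_def min_absorb1)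

section \<open>Splitting vectors into blocks\<close>

lemma norm_restrict_Un:
  assumes "C \<union> D \<subseteq> {..<n}" "\<And>e. e \<in> C \<union> D \<Longrightarrow> 0 \<le> v e"
  shows "f (restrict_vec v (C \<union> D)) \<le> f (restrict_vec v C) + f (restrict_vec v D)"
proof -
  have C: "restrict_vec v C \<in> nonneg_vecs n" and D: "restrict_vec v D \<in> nonneg_vecs n"
    using assms by (auto intro!: restrict_vec_nonneg)
  have "f (restrict_vec v (C \<union> D)) \<le> f (\<lambda>i. restrict_vec v C i + restrict_vec v D i)"
  proof (rule norm_mono)
    show "restrict_vec v (C \<union> D) \<in> nonneg_vecs n"
      using assms by (auto intro!: restrict_vec_nonneg)
    show "(\<lambda>i. restrict_vec v C i + restrict_vec v D i) \<in> nonneg_vecs n"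
      using C D by (auto simp: nonneg_vecs_def vecs_def)
    show "restrict_vec v (C \<union> D) i \<le> restrict_vec v C i + restrict_vec v D i" for i
      using assms(2)[of i] by (auto simp: restrict_vec_def)
  qed
  also have "\<dots> \<le> f (restrict_vec v C) + f (restrict_vec v D)"
    using C D by (intro norm_triangle nonneg_vecs_vecs)
  finally show ?thesis .
qed

text \<open>Blocks of \<open>k\<close> ones are split off one at a time. At most
  \<open>c / k + 1\<close> blocks arise, the last possibly partial, and by symmetry each has norm at
  most \<open>phi k\<close>.\<close>

lemma phi_le:
  assumes "c \<le> n" "0 < k"
  shows "phi c \<le> (real c / real k + 1) * phi k"
  using assms(1)
proof (induction c rule: less_induct)
  case (less c)
  show ?case
  proof (cases "c \<le> k")
    case True
    have "1 * phi k \<le> (real c / real k + 1) * phi k"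
      by (rule mult_right_mono[OF _ phi_nonneg]) simp
    then show ?thesis using phi_mono[OF True] by simp
  next
    case False
    have eq: "{..<c} = {..<k} \<union> {k..<c}" using False by auto
    have "phi c = f (ones {..<c})" using less.prems by (simp add: phi_def)
    also have "\<dots> \<le> f (ones {..<k}) + f (ones {k..<c})"
      unfolding eq by (rule norm_restrict_Un) (use less.prems False in auto)
    also have "\<dots> = phi k + phi (c - k)"
      using less.prems False norm_ones[of "{..<k}"] norm_ones[of "{k..<c}"] by (simp add: subset_eq)
    also have "\<dots> \<le> phi k + (real (c - k) / real k + 1) * phi k"
      using less False assms(2) by (intro add_left_mono less.IH) auto
    also have "\<dots> = (real c / real k + 1) * phi k"
      using False assms(2) by (simp add: of_nat_diff field_simps)
    finally show ?thesis .
  qed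
qed

text \<open>Every entry is at most \<open>\<tau> / b\<close>, so the vector lies below that multiple
  of the indicator of \<open>C\<close>. With \<open>b = phi k\<close> a block of at most
  \<open>k\<close> such elements has norm at most \<open>\<tau>\<close>.\<close>

lemma norm_restrict_le:
  assumes "C \<subseteq> {..<n}" "\<And>e. e \<in> C \<Longrightarrow> 0 \<le> v e \<and> v e * b \<le> \<tau>" "0 < b" "0 \<le> \<tau>"
  shows "f (restrict_vec v C) \<le> \<tau> * (phi (card C) / b)"
proof -
  have "f (restrict_vec v C) \<le> f (\<lambda>i. (\<tau> / b) * ones C i)"
  proof (rule norm_mono)
    show "restrict_vec v C \<in> nonneg_vecs n" using assms by (auto intro!: restrict_vec_nonneg)
    show "(\<lambda>i. (\<tau> / b) * ones C i) \<in> nonneg_vecs n"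
      using assms ones_vecs[OF assms(1)] by (auto simp: nonneg_vecs_def vecs_def)
    show "restrict_vec v C i \<le> (\<tau> / b) * ones C i" for i
      using assms by (auto simp: restrict_vec_def pos_le_divide_eq)
  qed
  also have "\<dots> = \<bar>\<tau> / b\<bar> * f (ones C)"
    by (rule norm_scale) (intro nonneg_vecs_vecs ones_vecs assms)
  also have "\<dots> = \<tau> * (phi (card C) / b)" using assms by (simp add: norm_ones)
  finally show ?thesis .
qed

lemma norm_restrict_sum:
  assumes "C \<subseteq> {..<n}" "\<And>e. e \<in> C \<Longrightarrow> 0 \<le> v e"
  shows "f (restrict_vec v C) \<le> (\<Sum>e\<in>C. v e * phi 1)"
proof -
  have "finite C" using assms(1) finite_subset by blast
  then show ?thesis using assms
  proof (induction C rule: finite_induct)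
    case empty
    have "f (\<lambda>i. 0 * ones {} i) = \<bar>0\<bar> * f (ones {})"
      by (intro norm_scale nonneg_vecs_vecs ones_vecs) simp
    then show ?case by (simp add: restrict_vec_def)
  next
    case (insert e C)
    have "f (restrict_vec v ({e} \<union> C)) \<le> f (restrict_vec v {e}) + f (restrict_vec v C)"
      by (rule norm_restrict_Un) (use insert.prems in auto)
    \<comment> \<open>With \<open>v e\<close> as threshold and \<open>b = 1\<close> the bound is
      exactly \<open>v e * phi 1\<close>.\<close>
    moreover have "f (restrict_vec v {e}) \<le> (v e) * (phi (card {e}) / 1)"
      by (rule norm_restrict_le) (use insert.prems in auto)
    ultimately show ?case using insert by simp
  qed
qed

text \<open>\<open>v e * phi k\<close> is the norm of \<open>k\<close> coordinates (at most
  \<open>n\<close>) all equal to \<open>v e\<close>: an element is heavy when \<open>k\<close> equal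
  copies of it would already exceed \<open>\<tau>\<close>.\<close>

definition heavy :: "(nat \<Rightarrow> real) \<Rightarrow> real \<Rightarrow> nat set \<Rightarrow> nat \<Rightarrow> nat set" where
  "heavy v \<tau> S k = {e \<in> S. \<tau> < v e * phi k}"

text \<open>
  The first summand makes the weight of elements above the top threshold dominate their
  contribution to the norm: the program does not know \<open>\<alpha>\<close> and so cannot forbid such elements by a
  large constant.
\<close>

definition weight :: "(nat \<Rightarrow> real) \<Rightarrow> nat \<Rightarrow> real \<Rightarrow> nat \<Rightarrow> real" where
  "weight v m \<tau> e = (if \<tau> < v e * phi 1 then v e * phi 1 else 0)
     + (\<Sum>l\<le>m. if \<tau> < v e * phi (2 ^ l) then \<tau> * 2 / 2 ^ l else 0)"

text \<open>Exchanging the two sums counts the charge by levels instead of by elements, the form in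
  which both later estimates use it.\<close>

lemma sum_weight:
  assumes "finite S"
  shows "(\<Sum>e\<in>S. weight v m \<tau> e) = (\<Sum>e\<in>heavy v \<tau> S 1. v e * phi 1)
     + (\<Sum>l\<le>m. \<tau> * 2 / 2 ^ l * card (heavy v \<tau> S (2 ^ l)))"
proof -
  have "(\<Sum>e\<in>S. \<Sum>l\<le>m. if \<tau> < v e * phi (2 ^ l) then \<tau> * 2 / 2 ^ l else 0)
      = (\<Sum>l\<le>m. \<Sum>e\<in>S. if \<tau> < v e * phi (2 ^ l) then \<tau> * 2 / 2 ^ l else 0)"
    by (rule sum.swap)
  also have "\<dots> = (\<Sum>l\<le>m. \<tau> * 2 / 2 ^ l * card (heavy v \<tau> S (2 ^ l)))"
    using assms by (intro sum.cong) (auto simp: heavy_def sum.If_cases Int_def)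
  finally show ?thesis
    using assms by (simp add: weight_def sum.distrib heavy_def sum.If_cases Int_def)
qed

lemma weight_nonneg_vecs:
  assumes "v \<in> nonneg_vecs n" "0 \<le> \<tau>"
  shows "weight v m \<tau> \<in> nonneg_vecs n"
proof -
  have v: "0 \<le> v e" "n \<le> e \<Longrightarrow> v e = 0" for e
    using assms(1) by (auto simp: nonneg_vecs_def vecs_def)
  have "0 \<le> weight v m \<tau> e" for e
    unfolding weight_def using v phi_nonneg assms(2) by (intro add_nonneg_nonneg sum_nonneg) auto
  moreover have "weight v m \<tau> e = 0" if "n \<le> e" for e
    using v(2)[OF that] assms(2) by (simp add: weight_def)
  ultimately show ?thesis by (simp add: nonneg_vecs_def vecs_def)
qed

section \<open>Comparison of norm and charge\<close>

lemma heavy_mono: "0 \<le> \<tau> \<Longrightarrow> (\<And>e. e \<in> S \<Longrightarrow> 0 \<le> v e) \<Longrightarrow> k \<le> l \<Longrightarrow> heavy v \<tau> S k \<subseteq> heavy v \<tau> S l"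
  by (auto simp: heavy_def intro: less_le_trans mult_left_mono phi_mono)

text \<open>Induction over the levels. Elements that become heavy only at level \<open>Suc m\<close>
  are light for \<open>2 ^ m\<close>, so each block of \<open>2 ^ m\<close> of them has norm at most
  \<open>\<tau>\<close>; the elements heavy at level \<open>0\<close> are paid for singly by the
  first sum.\<close>

lemma norm_heavy_le:
  assumes "0 < n" "S \<subseteq> {..<n}" "\<And>e. e \<in> S \<Longrightarrow> 0 \<le> v e" "0 \<le> \<tau>"
  shows "f (restrict_vec v (heavy v \<tau> S (2 ^ m)))
    \<le> (\<Sum>e\<in>heavy v \<tau> S 1. v e * phi 1)
      + (\<Sum>l\<le>m. \<tau> * 2 / 2 ^ l * card (heavy v \<tau> S (2 ^ l))) + m * \<tau>"
proof (induction m)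
  case 0
  have "f (restrict_vec v (heavy v \<tau> S 1)) \<le> (\<Sum>e\<in>heavy v \<tau> S 1. v e * phi 1)"
    using assms by (intro norm_restrict_sum) (auto simp: heavy_def)
  then show ?case using assms(4) by (auto intro: order_trans)
next
  case (Suc m)
  let ?H = "\<lambda>m. heavy v \<tau> S (2 ^ m)"
  let ?D = "?H (Suc m) - ?H m"
  have fin: "finite S" using assms(2) finite_subset by blast
  have sub: "?H m \<subseteq> ?H (Suc m)" by (rule heavy_mono) (use assms in auto)
  have HS: "?H (Suc m) \<subseteq> S" by (auto simp: heavy_def)
  have pos: "0 < phi (2 ^ m)" using assms(1) by (simp add: phi_pos)
  have "f (restrict_vec v (?H m \<union> ?D)) \<le> f (restrict_vec v (?H m)) + f (restrict_vec v ?D)"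
    by (rule norm_restrict_Un) (use HS sub assms in auto)
  moreover have "?H m \<union> ?D = ?H (Suc m)" using sub by auto
  moreover have "f (restrict_vec v ?D) \<le> \<tau> * (phi (card ?D) / phi (2 ^ m))"
    by (rule norm_restrict_le) (use pos HS assms in \<open>auto simp: heavy_def not_less\<close>)
  moreover have "\<dots> \<le> \<tau> * (real (card (?H (Suc m))) / 2 ^ m + 1)"
  proof -
    have "card ?D \<le> n" using HS assms(2) card_mono[of "{..<n}" ?D] by auto
    then have "phi (card ?D) / phi (2 ^ m) \<le> real (card ?D) / 2 ^ m + 1"
      using phi_le[of "card ?D" "2 ^ m"] pos by (simp add: pos_divide_le_eq)
    also have "real (card ?D) \<le> real (card (?H (Suc m)))"
      using HS fin by (intro of_nat_mono card_mono) (auto intro: finite_subset)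
    finally show ?thesis
      using assms(4) by (intro mult_left_mono) (auto simp: divide_right_mono)
  qed
  \<comment> \<open>\<open>\<tau> / 2 ^ m\<close> is \<open>\<tau> * 2 / 2 ^ Suc m\<close>: the
    factor \<open>2\<close> in the charges turns the count of full blocks into the new summand, and
    the partial block costs one further \<open>\<tau>\<close>.\<close>
  ultimately show ?case using Suc.IH by (simp add: algebra_simps)
qed

lemma norm_le_weight:
  assumes "0 < n" "n \<le> 2 ^ m" "S \<subseteq> {..<n}" "\<And>e. e \<in> S \<Longrightarrow> 0 \<le> v e" "0 \<le> \<tau>"
  shows "f (restrict_vec v S) \<le> (\<Sum>e\<in>S. weight v m \<tau> e) + (m + 1) * \<tau>"
proof -
  let ?H = "heavy v \<tau> S (2 ^ m)"
  have fin: "finite S" using assms(3) finite_subset by blast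
  have HS: "?H \<subseteq> S" by (auto simp: heavy_def)
  have pos: "0 < phi (2 ^ m)" using assms(1) by (simp add: phi_pos)
  have "f (restrict_vec v (?H \<union> (S - ?H))) \<le> f (restrict_vec v ?H) + f (restrict_vec v (S - ?H))"
    by (rule norm_restrict_Un) (use HS assms in auto)
  moreover have "?H \<union> (S - ?H) = S" using HS by auto
  moreover have "f (restrict_vec v (S - ?H)) \<le> \<tau> * (phi (card (S - ?H)) / phi (2 ^ m))"
    by (rule norm_restrict_le) (use pos HS assms in \<open>auto simp: heavy_def not_less\<close>)
  \<comment> \<open>As \<open>n \<le> 2 ^ m\<close>, everything light at the top level fits into a
    single block.\<close>
  moreover have "\<dots> \<le> \<tau> * 1"
  proof -
    have "card (S - ?H) \<le> n" using assms(3) card_mono[of "{..<n}" "S - ?H"] by auto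
    then have "phi (card (S - ?H)) \<le> phi (2 ^ m)" using assms(2) by (intro phi_mono) linarith
    then show ?thesis using assms(5) pos by (intro mult_left_mono) auto
  qed
  moreover have "f (restrict_vec v ?H) \<le> (\<Sum>e\<in>S. weight v m \<tau> e) + m * \<tau>"
    unfolding sum_weight[OF fin] by (rule norm_heavy_le) (use assms in auto)
  ultimately show ?thesis by (simp add: algebra_simps)
qed

text \<open>If \<open>k\<close> elements were heavy and \<open>t\<close> were the least value among
  them, \<open>T\<close> would dominate \<open>t\<close> times an indicator of at least
  \<open>k\<close> elements, whose norm is at least \<open>t * phi k\<close> and hence above the
  norm of \<open>T\<close>.\<close>

lemma card_heavy_less:
  assumes "T \<subseteq> {..<n}" "\<And>e. e \<in> T \<Longrightarrow> 0 \<le> v e" "0 < k"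
  shows "card (heavy v (f (restrict_vec v T)) T k) < k"
proof (rule ccontr)
  let ?C = "heavy v (f (restrict_vec v T)) T k"
  assume "\<not> ?thesis"
  then have k: "k \<le> card ?C" by simp
  have CT: "?C \<subseteq> T" by (auto simp: heavy_def)
  have fin: "finite ?C" using CT assms(1) by (meson finite_lessThan finite_subset)
  define t where "t = Min (v ` ?C)"
  have ne: "?C \<noteq> {}" using k assms(3) by auto
  \<comment> \<open>The minimum is attained at a heavy element, which gives the strict inequality
    for \<open>t\<close>.\<close>
  have "t \<in> v ` ?C" using fin ne by (simp add: t_def)
  then have t: "f (restrict_vec v T) < t * phi k" "0 \<le> t"
    using assms(2) by (auto simp: heavy_def)
  have "t * phi k \<le> t * phi (card ?C)" using k t(2) by (intro mult_left_mono phi_mono)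
  also have "\<dots> = \<bar>t\<bar> * f (ones ?C)" using CT assms(1) t(2) by (subst norm_ones) auto
  also have "\<dots> = f (\<lambda>i. t * ones ?C i)"
    by (rule norm_scale[symmetric]) (use CT assms in \<open>auto intro!: nonneg_vecs_vecs ones_vecs\<close>)
  also have "\<dots> \<le> f (restrict_vec v T)"
  proof (rule norm_mono)
    show "(\<lambda>i. t * ones ?C i) \<in> nonneg_vecs n"
      using CT assms(1) t(2) ones_vecs[of ?C] by (auto simp: nonneg_vecs_def vecs_def)
    show "restrict_vec v T \<in> nonneg_vecs n" using assms by (auto intro!: restrict_vec_nonneg)
    show "t * ones ?C i \<le> restrict_vec v T i" for i
      using CT fin assms(2)[of i] by (auto simp: restrict_vec_def t_def)
  qed
  finally show False using t(1) by simp
qed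

text \<open>A level \<open>l\<close> with fewer than \<open>2 ^ l\<close> heavy elements, each
  charged \<open>\<tau> * 2 / 2 ^ l\<close>, costs at most \<open>2 * \<tau>\<close>.\<close>

lemma sum_weight_le:
  assumes "finite T" "0 \<le> \<tau>" "\<And>l. l \<le> m \<Longrightarrow> card (heavy v \<tau> T (2 ^ l)) < 2 ^ l"
  shows "(\<Sum>e\<in>T. weight v m \<tau> e) \<le> 2 * real m * \<tau>"
proof -
  \<comment> \<open>Fewer than \<open>2 ^ 0\<close> heavy elements means none. This removes both the
    first summand and level \<open>0\<close>, so \<open>m\<close> levels remain instead of
    \<open>m + 1\<close>.\<close>
  have H0: "heavy v \<tau> T 1 = {}"
    using assms(1) assms(3)[of 0] by (auto simp: heavy_def)
  have "(\<Sum>l\<le>m. \<tau> * 2 / 2 ^ l * card (heavy v \<tau> T (2 ^ l)))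
      = (\<Sum>l\<in>{1..m}. \<tau> * 2 / 2 ^ l * card (heavy v \<tau> T (2 ^ l)))"
    using H0 by (intro sum.mono_neutral_right) (auto simp: not_le)
  also have "\<dots> \<le> (\<Sum>l\<in>{1..m}. 2 * \<tau>)"
  proof (rule sum_mono)
    fix l assume "l \<in> {1..m}"
    then have "card (heavy v \<tau> T (2 ^ l)) < 2 ^ l" using assms(3) by simp
    then have "real (card (heavy v \<tau> T (2 ^ l))) \<le> 2 ^ l"
      by (metis less_imp_le of_nat_le_iff of_nat_numeral of_nat_power)
    then have "\<tau> * 2 / 2 ^ l * card (heavy v \<tau> T (2 ^ l)) \<le> \<tau> * 2 / 2 ^ l * 2 ^ l"
      using assms(2) by (intro mult_left_mono) auto
    then show "\<tau> * 2 / 2 ^ l * card (heavy v \<tau> T (2 ^ l)) \<le> 2 * \<tau>" by simp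
  qed
  finally show ?thesis unfolding sum_weight[OF assms(1)] H0 by simp
qed

text \<open>
  The threshold is the largest product \<open>v e * phi (2 ^ i)\<close> not exceeding the optimum: it is
  one of polynomially many candidates and separates these products exactly as the optimum does.
  The index \<open>e = n\<close>, where \<open>v\<close> vanishes, supplies the threshold \<open>0\<close>.
\<close>

lemma good_threshold:
  assumes "0 < n" "v \<in> nonneg_vecs n" "T \<subseteq> {..<n}"
  obtains e i where "e \<le> n" "i \<le> m" "v e * phi (2 ^ i) \<le> f (restrict_vec v T)"
    "\<And>l. l \<le> m \<Longrightarrow> card (heavy v (v e * phi (2 ^ i)) T (2 ^ l)) < 2 ^ l"
proof -
  have v: "0 \<le> v e" "n \<le> e \<Longrightarrow> v e = 0" for e
    using assms(2) by (auto simp: nonneg_vecs_def vecs_def)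
  let ?C = "(\<lambda>(e, i). v e * phi (2 ^ i)) ` ({..n} \<times> {..m})"
  let ?D = "{\<tau> \<in> ?C. \<tau> \<le> f (restrict_vec v T)}"
  have "restrict_vec v T \<in> nonneg_vecs n" using assms(3) v by (intro restrict_vec_nonneg) auto
  then have "0 \<le> f (restrict_vec v T)" by (intro norm_nonneg nonneg_vecs_vecs)
  moreover have "0 \<in> ?C" using v(2)[of n] by (force simp: image_iff)
  ultimately have "0 \<in> ?D" by blast
  then have ne: "?D \<noteq> {}" by blast
  have fin: "finite ?D" by auto
  define \<tau> where "\<tau> = Max ?D"
  have \<tau>: "\<tau> \<in> ?D" unfolding \<tau>_def using fin ne by (rule Max_in)
  then obtain e i where ei: "e \<le> n" "i \<le> m" "\<tau> = v e * phi (2 ^ i)" by auto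
  have "card (heavy v \<tau> T (2 ^ l)) < 2 ^ l" if "l \<le> m" for l
  proof -
    \<comment> \<open>By maximality no candidate is above \<open>\<tau>\<close> and at most the norm
      of \<open>T\<close>, so a product exceeding \<open>\<tau>\<close> exceeds that norm
      too.\<close>
    have "f (restrict_vec v T) < v e * phi (2 ^ l)" if "e \<in> T" "\<tau> < v e * phi (2 ^ l)" for e
    proof (rule ccontr)
      assume "\<not> ?thesis"
      moreover have "v e * phi (2 ^ l) \<in> ?C" using that(1) assms(3) \<open>l \<le> m\<close> by force
      ultimately have "v e * phi (2 ^ l) \<le> \<tau>" unfolding \<tau>_def by (intro Max_ge fin) auto
      then show False using that(2) by simp
    qed
    then have "heavy v \<tau> T (2 ^ l) \<subseteq> heavy v (f (restrict_vec v T)) T (2 ^ l)"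
      by (auto simp: heavy_def)
    moreover have "finite T" using assms(3) finite_subset by blast
    ultimately have "card (heavy v \<tau> T (2 ^ l)) \<le> card (heavy v (f (restrict_vec v T)) T (2 ^ l))"
      by (intro card_mono) (auto simp: heavy_def)
    also have "\<dots> < 2 ^ l" by (rule card_heavy_less) (use assms v in auto)
    finally show ?thesis .
  qed
  then show thesis using \<tau> ei by (intro that[of e i]) auto
qed

text \<open>The pair \<open>e\<close>, \<open>i\<close> is fixed before \<open>S\<close>: for this
  threshold every approximate minimizer is good, whichever one the min-sum program happens to
  return.\<close>

lemma threshold_approx:
  assumes "0 < n" "v \<in> nonneg_vecs n" "n \<le> 2 ^ m" "1 \<le> m" "F \<subseteq> Pow {..<n}" "1 \<le> a" "T \<in> F"
  obtains e i where "e \<le> n" "i \<le> m"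
    "\<And>S. approx_minimizer F (\<lambda>S. \<Sum>e'\<in>S. weight v m (v e * phi (2 ^ i)) e') a S \<Longrightarrow>
       f (restrict_vec v S) \<le> 4 * a * m * f (restrict_vec v T)"
proof -
  have v: "0 \<le> v e" for e using assms(2) by (auto simp: nonneg_vecs_def)
  have T: "T \<subseteq> {..<n}" using assms by auto
  obtain e i where ei: "e \<le> n" "i \<le> m" "v e * phi (2 ^ i) \<le> f (restrict_vec v T)"
    "\<And>l. l \<le> m \<Longrightarrow> card (heavy v (v e * phi (2 ^ i)) T (2 ^ l)) < 2 ^ l"
    using good_threshold[OF assms(1,2) T] by blast
  define \<tau> where "\<tau> = v e * phi (2 ^ i)"
  have \<tau>: "0 \<le> \<tau>" using v phi_nonneg by (simp add: \<tau>_def)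
  have "f (restrict_vec v S) \<le> 4 * a * m * f (restrict_vec v T)"
    if S: "approx_minimizer F (\<lambda>S. \<Sum>e'\<in>S. weight v m \<tau> e') a S" for S
  proof -
    have "S \<subseteq> {..<n}" using S assms(5) by (auto simp: approx_minimizer_def)
    then have "f (restrict_vec v S) \<le> (\<Sum>e\<in>S. weight v m \<tau> e) + (m + 1) * \<tau>"
      using norm_le_weight[of m S v \<tau>] assms(1,3) v \<tau> by (simp add: add.commute)
    also have "(\<Sum>e\<in>S. weight v m \<tau> e) \<le> a * (\<Sum>e\<in>T. weight v m \<tau> e)"
      using S assms(7) by (auto simp: approx_minimizer_def)
    also have "(\<Sum>e\<in>T. weight v m \<tau> e) \<le> 2 * real m * \<tau>"
      using ei(4) T \<tau> by (intro sum_weight_le) (auto simp: \<tau>_def intro: finite_subset)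
    finally have "f (restrict_vec v S) \<le> a * (2 * real m * \<tau>) + (m + 1) * \<tau>"
      using assms(6) by simp
    \<comment> \<open>The additive loss is absorbed by
      \<open>m + 1 \<le> 2 * m \<le> 2 * a * m\<close>, using \<open>1 \<le> m\<close> and
      \<open>1 \<le> a\<close>.\<close>
    also have "real (m + 1) * \<tau> \<le> (a * (2 * real m)) * \<tau>"
    proof (rule mult_right_mono[OF _ \<tau>])
      have "1 * (2 * real m) \<le> a * (2 * real m)" using assms(6) by (intro mult_right_mono) auto
      then show "real (m + 1) \<le> a * (2 * real m)" using assms(4) by linarith
    qed
    also have "a * (2 * real m * \<tau>) + (a * (2 * real m)) * \<tau> = 4 * a * m * \<tau>" by simp
    also have "\<dots> \<le> 4 * a * m * f (restrict_vec v T)"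
      using ei(3) assms(6) by (intro mult_left_mono) (auto simp: \<tau>_def)
    finally show ?thesis by simp
  qed
  then show thesis using ei(1,2) by (intro that[of e i]) (auto simp: \<tau>_def)
qed

end

section \<open>Timed reasoning about real RAM programs\<close>

primrec iexp_bound :: "iexp \<Rightarrow> nat" where
  "iexp_bound (IConst k) = 0"
| "iexp_bound (IVar i) = Suc i"
| "iexp_bound (IAdd a b) = max (iexp_bound a) (iexp_bound b)"
| "iexp_bound (ISub a b) = max (iexp_bound a) (iexp_bound b)"

primrec rexp_bound :: "rexp \<Rightarrow> nat" where
  "rexp_bound (RConst k) = 0"
| "rexp_bound (RIdx a) = iexp_bound a"
| "rexp_bound (RCell a i) = max (Suc a) (iexp_bound i)"
| "rexp_bound (RAdd a b) = max (rexp_bound a) (rexp_bound b)"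
| "rexp_bound (RSub a b) = max (rexp_bound a) (rexp_bound b)"
| "rexp_bound (RMul a b) = max (rexp_bound a) (rexp_bound b)"
| "rexp_bound (RDiv a b) = max (rexp_bound a) (rexp_bound b)"

primrec bexp_bound :: "bexp \<Rightarrow> nat" where
  "bexp_bound (ILess a b) = max (iexp_bound a) (iexp_bound b)"
| "bexp_bound (RLess a b) = max (rexp_bound a) (rexp_bound b)"
| "bexp_bound (BNot b) = bexp_bound b"
| "bexp_bound (BAnd b c) = max (bexp_bound b) (bexp_bound c)"

text \<open>One strict bound serves index registers and arrays alike, so a single number
  \<open>K\<close> separates the locations of \<open>A\<close> from those of the surrounding
  program.\<close>

primrec com_bound :: "com \<Rightarrow> nat" where
  "com_bound Skip = 0"
| "com_bound (SetIdx i e) = max (Suc i) (iexp_bound e)"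
| "com_bound (SetCell a i e) = max (Suc a) (max (iexp_bound i) (rexp_bound e))"
| "com_bound (Fresh a) = Suc a"
| "com_bound (Query a i b) = max (Suc a) (max (iexp_bound i) (Suc b))"
| "com_bound (Seq c d) = max (com_bound c) (com_bound d)"
| "com_bound (Cond b c d) = max (bexp_bound b) (max (com_bound c) (com_bound d))"
| "com_bound (Loop b c) = max (bexp_bound b) (com_bound c)"

primrec writes_idx :: "com \<Rightarrow> nat set" where
  "writes_idx Skip = {}"
| "writes_idx (SetIdx i e) = {i}"
| "writes_idx (SetCell a i e) = {}"
| "writes_idx (Fresh a) = {}"
| "writes_idx (Query a i b) = {}"
| "writes_idx (Seq c d) = writes_idx c \<union> writes_idx d"
| "writes_idx (Cond b c d) = writes_idx c \<union> writes_idx d"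
| "writes_idx (Loop b c) = writes_idx c"

primrec writes_arr :: "com \<Rightarrow> nat set" where
  "writes_arr Skip = {}"
| "writes_arr (SetIdx i e) = {}"
| "writes_arr (SetCell a i e) = {a}"
| "writes_arr (Fresh a) = {a}"
| "writes_arr (Query a i b) = {a}"
| "writes_arr (Seq c d) = writes_arr c \<union> writes_arr d"
| "writes_arr (Cond b c d) = writes_arr c \<union> writes_arr d"
| "writes_arr (Loop b c) = writes_arr c"

lemma state_update_simps [simp]:
  "idx (set_idx i k s) = (idx s)(i := k)"
  "arr (set_idx i k s) = arr s"
  "idx (set_arr a x s) = idx s"
  "arr (set_arr a x s) = (arr s)(a := x)"
  "idx (set_cell a j r s) = idx s"
  "arr (set_cell a j r s) = (arr s)(a := (arr s a)(j := r))"
  by (simp_all add: set_idx_def set_arr_def set_cell_def)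

lemma exec_frame:
  assumes "exec orc c s t s'"
  shows "i \<notin> writes_idx c \<Longrightarrow> idx s' i = idx s i"
    and "a \<notin> writes_arr c \<Longrightarrow> arr s' a = arr s a"
  using assms by (induction rule: exec.induct) auto

definition frame :: "com \<Rightarrow> ram_state \<Rightarrow> ram_state \<Rightarrow> bool" where
  "frame c s s' \<longleftrightarrow>
     (\<forall>i. i \<notin> writes_idx c \<longrightarrow> idx s' i = idx s i) \<and> (\<forall>a. a \<notin> writes_arr c \<longrightarrow> arr s' a = arr s a)"

lemma frame_idx: "frame c s s' \<Longrightarrow> i \<notin> writes_idx c \<Longrightarrow> idx s' i = idx s i"
  and frame_arr: "frame c s s' \<Longrightarrow> a \<notin> writes_arr c \<Longrightarrow> arr s' a = arr s a"
  by (auto simp: frame_def)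

definition agree :: "nat \<Rightarrow> ram_state \<Rightarrow> ram_state \<Rightarrow> bool" where
  "agree K s u \<longleftrightarrow> (\<forall>i<K. idx s i = idx u i \<and> arr s i = arr u i)"

lemma ival_agree: "agree K s u \<Longrightarrow> iexp_bound e \<le> K \<Longrightarrow> ival e s = ival e u"
  by (induction e) (auto simp: agree_def)

lemma rval_agree: "agree K s u \<Longrightarrow> rexp_bound e \<le> K \<Longrightarrow> rval e s = rval e u"
  by (induction e) (auto simp: ival_agree, auto simp: agree_def)

lemma bval_agree: "agree K s u \<Longrightarrow> bexp_bound e \<le> K \<Longrightarrow> bval e s = bval e u"
  by (induction e) (auto simp: ival_agree rval_agree)

text \<open>Without queries a program depends only on the locations below its bound, so two runs
  proceed in lockstep, with equal step counts, whatever the oracles and the remaining locations are.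
  This allows \<open>A\<close> to be used as a subroutine.\<close>

lemma exec_agree:
  assumes "exec orc c s t s'" "oracle_free c" "com_bound c \<le> K" "agree K s u"
  shows "\<exists>u'. exec orc' c u t u' \<and> agree K s' u'"
  using assms
proof (induction arbitrary: u rule: exec.induct)
  case (exec_Skip s)
  then show ?case using exec.exec_Skip by blast
next
  case (exec_SetIdx i e s)
  then have "agree K (set_idx i (ival e s) s) (set_idx i (ival e u) u)"
    using ival_agree[of K s u e] by (auto simp: agree_def)
  then show ?case using exec.exec_SetIdx by blast
next
  case (exec_SetCell a i e s)
  then have "agree K (set_cell a (ival i s) (rval e s) s) (set_cell a (ival i u) (rval e u) u)"
    using ival_agree[of K s u i] rval_agree[of K s u e] by (auto simp: agree_def)
  then show ?case using exec.exec_SetCell by blast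
next
  case (exec_Fresh a s)
  then have "agree K (set_arr a (\<lambda>_. 0) s) (set_arr a (\<lambda>_. 0) u)"
    by (auto simp: agree_def)
  then show ?case using exec.exec_Fresh by blast
next
  case (exec_Seq c s t s' d r s'')
  then obtain u' where "exec orc' c u t u'" "agree K s' u'" by auto
  moreover then obtain u'' where "exec orc' d u' r u''" "agree K s'' u''"
    using exec_Seq by force
  ultimately show ?case using exec.exec_Seq by blast
next
  case (exec_CondT b s c t s' d)
  then obtain u' where "exec orc' c u t u'" "agree K s' u'" by auto
  moreover have "bval b u" using exec_CondT bval_agree[of K s u b] by simp
  ultimately show ?case using exec.exec_CondT by blast
next
  case (exec_CondF b s d t s' c)
  then obtain u' where "exec orc' d u t u'" "agree K s' u'" by auto
  moreover have "\<not> bval b u" using exec_CondF bval_agree[of K s u b] by simp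
  ultimately show ?case using exec.exec_CondF by blast
next
  case (exec_LoopF b s c)
  then have "\<not> bval b u" using bval_agree[of K s u b] by simp
  then show ?case using exec_LoopF exec.exec_LoopF by blast
next
  case (exec_LoopT b s c t s' r s'')
  then obtain u' where "exec orc' c u t u'" "agree K s' u'" by auto
  moreover then obtain u'' where "exec orc' (Loop b c) u' r u''" "agree K s'' u''"
    using exec_LoopT by force
  moreover have "bval b u" using exec_LoopT bval_agree[of K s u b] by simp
  ultimately show ?case using exec.exec_LoopT by blast
qed simp

lemma writes_less_com_bound:
  "i \<in> writes_idx c \<Longrightarrow> i < com_bound c" "i \<in> writes_arr c \<Longrightarrow> i < com_bound c"
  by (induction c) auto

section \<open>Total correctness with time bounds\<close>

definition runs ::
  "((nat \<Rightarrow> real) \<Rightarrow> real) \<Rightarrow> com \<Rightarrow> nat \<Rightarrow> (ram_state \<Rightarrow> bool) \<Rightarrow> ram_state \<Rightarrow> bool" where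
  "runs orc c T Q s \<longleftrightarrow> (\<exists>t s'. exec orc c s t s' \<and> t \<le> T \<and> Q s')"

lemma runs_mono:
  "runs orc c T Q s \<Longrightarrow> T \<le> T' \<Longrightarrow> (\<And>s'. Q s' \<Longrightarrow> Q' s') \<Longrightarrow> runs orc c T' Q' s"
  unfolding runs_def using order_trans by blast

lemma runs_frame:
  "runs orc c T Q s \<Longrightarrow> runs orc c T (\<lambda>s'. Q s' \<and> frame c s s') s"
  unfolding runs_def frame_def using exec_frame by blast

lemma runs_Skip: "Q s \<Longrightarrow> runs orc Skip 1 Q s"
  unfolding runs_def using exec_Skip by blast

lemma runs_SetIdx: "Q (set_idx i (ival e s) s) \<Longrightarrow> runs orc (SetIdx i e) 1 Q s"
  unfolding runs_def using exec_SetIdx by blast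

lemma runs_SetCell: "Q (set_cell a (ival i s) (rval e s) s) \<Longrightarrow> runs orc (SetCell a i e) 1 Q s"
  unfolding runs_def using exec_SetCell by blast

lemma runs_Fresh: "Q (set_arr a (\<lambda>_. 0) s) \<Longrightarrow> runs orc (Fresh a) 1 Q s"
  unfolding runs_def using exec_Fresh by blast

lemma runs_Query: "Q (set_cell a (ival i s) (orc (arr s b)) s) \<Longrightarrow> runs orc (Query a i b) 1 Q s"
  unfolding runs_def using exec_Query by blast

lemma runs_Seq:
  assumes "runs orc c T R s" "\<And>s'. R s' \<Longrightarrow> runs orc d U Q s'"
  shows "runs orc (Seq c d) (T + U) Q s"
  using assms unfolding runs_def by (meson add_mono exec_Seq)

lemma runs_Cond:
  assumes "bval b s \<Longrightarrow> runs orc c T Q s" "\<not> bval b s \<Longrightarrow> runs orc d T Q s"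
  shows "runs orc (Cond b c d) (T + 1) Q s"
  using assms unfolding runs_def by (metis add_le_mono1 exec_CondT exec_CondF)

text \<open>The invariant carries the round number, which fixes the number of rounds as
  \<open>N\<close>. A round costs its body and one test; the final \<open>1\<close> is the failing
  test.\<close>

lemma runs_Loop:
  assumes "\<And>j s. j < N \<Longrightarrow> I j s \<Longrightarrow> bval b s \<and> runs orc c T (I (Suc j)) s"
    and "\<And>s. I N s \<Longrightarrow> \<not> bval b s"
    and "I 0 s"
  shows "runs orc (Loop b c) (N * (T + 1) + 1) (I N) s"
proof -
  \<comment> \<open>Generalised to a start in round \<open>j\<close> with \<open>N - j\<close>
    rounds left, then proved downwards from \<open>N\<close>.\<close>
  have "runs orc (Loop b c) ((N - j) * (T + 1) + 1) (I N) s" if "I j s" "j \<le> N" for j s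
    using that(2,1)
  proof (induction j arbitrary: s rule: inc_induct)
    case base
    then show ?case using assms(2) exec_LoopF unfolding runs_def by fastforce
  next
    case (step j)
    obtain t s' where t: "exec orc c s t s'" "t \<le> T" "I (Suc j) s'"
      using assms(1) step.hyps step.prems unfolding runs_def by blast
    obtain u s'' where u: "exec orc (Loop b c) s' u s''" "u \<le> (N - Suc j) * (T + 1) + 1" "I N s''"
      using step.IH[OF t(3)] unfolding runs_def by blast
    have "exec orc (Loop b c) s (t + u + 1) s''"
      using assms(1) step.hyps step.prems t(1) u(1) by (blast intro: exec_LoopT)
    moreover have "N - j = Suc (N - Suc j)" using step.hyps by simp
    then have "t + u + 1 \<le> (N - j) * (T + 1) + 1" using t(2) u(2) by simp
    ultimately show ?case using u(3) unfolding runs_def by blast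
  qed
  from this[OF assms(3)] show ?thesis by simp
qed

definition For :: "nat \<Rightarrow> iexp \<Rightarrow> com \<Rightarrow> com" where
  "For r e c = Seq (SetIdx r (IConst 0))
     (Loop (ILess (IVar r) e) (Seq c (SetIdx r (IAdd (IVar r) (IConst 1)))))"

lemma writes_For [simp]:
  "writes_idx (For r e c) = insert r (writes_idx c)" "writes_arr (For r e c) = writes_arr c"
  by (auto simp: For_def)

text \<open>The limit is evaluated anew at each test, so the invariant must determine it, and the
  invariant must survive the updates of the counter. A round costs body, increment and test; the
  outer \<open>2\<close> is initialisation and failing test.\<close>

lemma runs_For:
  assumes body: "\<And>j s. j < N \<Longrightarrow> I j s \<Longrightarrow> idx s r = j \<Longrightarrow> runs orc c T (I (Suc j)) s"
    and lim: "\<And>j s. I j s \<Longrightarrow> ival e s = N"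
    and I: "\<And>j k s. I j s \<Longrightarrow> I j (set_idx r k s)"
    and r: "r \<notin> writes_idx c"
    and "I 0 s"
  shows "runs orc (For r e c) (N * (T + 2) + 2) (I N) s"
proof -
  let ?J = "\<lambda>j s. I j s \<and> idx s r = j"
  have "runs orc (Loop (ILess (IVar r) e) (Seq c (SetIdx r (IAdd (IVar r) (IConst 1)))))
      (N * ((T + 1) + 1) + 1) (?J N) (set_idx r 0 s)"
  proof (rule runs_Loop)
    fix j s assume j: "j < N" and J: "?J j s"
    have "runs orc c T (\<lambda>s'. I (Suc j) s' \<and> frame c s s') s"
      using body[OF j] J by (blast intro: runs_frame)
    then have "runs orc (Seq c (SetIdx r (IAdd (IVar r) (IConst 1)))) (T + 1) (?J (Suc j)) s"
      by (rule runs_Seq, intro runs_SetIdx) (use J r I in \<open>auto simp: frame_idx\<close>)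
    then show "bval (ILess (IVar r) e) s \<and>
        runs orc (Seq c (SetIdx r (IAdd (IVar r) (IConst 1)))) (T + 1) (?J (Suc j)) s"
      using j J lim by auto
  qed (use lim I assms(5) in auto)
  then have "runs orc (For r e c) (1 + (N * ((T + 1) + 1) + 1)) (?J N) s"
    unfolding For_def by (intro runs_Seq[OF runs_SetIdx[where Q = "\<lambda>s'. s' = set_idx r 0 s"]]) auto
  then show ?thesis by (rule runs_mono) auto
qed

text \<open>Weakest-precondition form: with the start state as last argument, a run of the second
  program is itself a postcondition of the first, and no intermediate assertion has to be
  named.\<close>

lemma runs_Seq_wp:
  "runs orc c T (\<lambda>s'. runs orc d U Q s') s \<Longrightarrow> runs orc (Seq c d) (T + U) Q s"
  by (rule runs_Seq)

text \<open>The frame comes for free here, so the specification of a fragment has to mention only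
  what it changes.\<close>

lemma runs_conseq:
  assumes "runs orc c T R s" "\<And>s'. R s' \<Longrightarrow> frame c s s' \<Longrightarrow> Q s'"
  shows "runs orc c T Q s"
  using runs_mono[OF runs_frame[OF assms(1)]] assms(2) by blast

section \<open>Copying arrays and clearing locations\<close>

definition Copy :: "nat \<Rightarrow> nat \<Rightarrow> nat \<Rightarrow> nat \<Rightarrow> com" where
  "Copy r q a b = For r (IVar q) (SetCell b (IVar r) (RCell a (IVar r)))"

lemma writes_Copy [simp]:
  "writes_idx (Copy r q a b) = {r}" "writes_arr (Copy r q a b) = {b}"
  by (auto simp: Copy_def)

lemma runs_Copy:
  assumes "a \<noteq> b" "q \<noteq> r"
  shows "runs orc (Copy r q a b) (idx s q * 3 + 2)
    (\<lambda>s'. arr s' b = (\<lambda>i. if i < idx s q then arr s a i else arr s b i)) s"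
proof -
  let ?I = "\<lambda>j s'. idx s' q = idx s q \<and> arr s' a = arr s a
    \<and> arr s' b = (\<lambda>i. if i < j then arr s a i else arr s b i)"
  have "runs orc (Copy r q a b) (idx s q * (1 + 2) + 2) (?I (idx s q)) s"
    unfolding Copy_def
    by (rule runs_For[where I = ?I]; (rule runs_SetCell)?)
      (use assms in \<open>auto simp: less_Suc_eq fun_eq_iff\<close>)
  then show ?thesis by (rule runs_mono) auto
qed

text \<open>A call of \<open>A\<close> leaves garbage behind, while its guarantee speaks only of
  runs from a clean input state.\<close>

primrec reset :: "nat \<Rightarrow> com" where
  "reset 0 = Skip"
| "reset (Suc k) = Seq (reset k) (Seq (SetIdx k (IConst 0)) (Fresh k))"

lemma writes_reset [simp]: "writes_idx (reset k) = {..<k}" "writes_arr (reset k) = {..<k}"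
  by (induction k) (simp_all add: lessThan_Suc Un_insert_right)

lemma runs_reset:
  "runs orc (reset k) (2 * k + 1) (\<lambda>s'. \<forall>i<k. idx s' i = 0 \<and> arr s' i = (\<lambda>_. 0)) s"
proof (induction k)
  case 0
  show ?case using runs_Skip[of "\<lambda>_. True"] by simp
next
  case (Suc k)
  have "runs orc (reset (Suc k)) ((2 * k + 1) + (1 + 1))
      (\<lambda>s'. \<forall>i<Suc k. idx s' i = 0 \<and> arr s' i = (\<lambda>_. 0)) s"
    unfolding reset.simps
    by (rule runs_Seq[OF Suc.IH], rule runs_Seq_wp, rule runs_SetIdx, rule runs_Fresh)
      (auto simp: less_Suc_eq)
  then show ?case by (rule runs_mono) auto
qed

section \<open>The approximation program\<close>

text \<open>
  The min-sum program \<open>A\<close> owns the registers and arrays below \<open>K\<close>; ours start at \<open>K + 3\<close>, so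
  that they are also disjoint from the input and output locations \<open>0\<close>, \<open>1\<close>, \<open>2\<close>.
\<close>

abbreviation (input) "rLen K \<equiv> K + 3"
abbreviation (input) "rDim K \<equiv> K + 4"
abbreviation (input) "rLev K \<equiv> K + 5"
abbreviation (input) "rPow K \<equiv> K + 6"
abbreviation (input) "rJ K \<equiv> K + 7"
abbreviation (input) "rE K \<equiv> K + 8"
abbreviation (input) "rI K \<equiv> K + 9"
abbreviation (input) "rL K \<equiv> K + 10"
abbreviation (input) "aInst K \<equiv> K + 3"
abbreviation (input) "aVal K \<equiv> K + 4"
abbreviation (input) "aPhi K \<equiv> K + 5"
abbreviation (input) "aPow K \<equiv> K + 6"
abbreviation (input) "aQuery K \<equiv> K + 7"
abbreviation (input) "aBest K \<equiv> K + 8"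
abbreviation (input) "aOpt K \<equiv> K + 9"
abbreviation (input) "aThr K \<equiv> K + 10"
abbreviation (input) "aCur K \<equiv> K + 11"

text \<open>The powers of two below \<open>2 * n\<close> are the levels \<open>0\<close> to
  \<open>m\<close>, so \<open>m\<close> is found by doubling, without logarithm or multiplication.
  The run of ones in the query array only grows, so the array is kept from round to round.\<close>

definition levels_prog :: "nat \<Rightarrow> com" where
  "levels_prog K = Seq (SetIdx (rPow K) (IConst 1))
     (Loop (ILess (IVar (rPow K)) (IAdd (IVar (rDim K)) (IVar (rDim K))))
       (Seq (For (rJ K) (IVar (rPow K)) (SetCell (aQuery K) (IVar (rJ K)) (RConst 1)))
       (Seq (Query (aPhi K) (IVar (rLev K)) (aQuery K))
       (Seq (SetCell (aPow K) (IVar (rLev K)) (RIdx (IVar (rPow K))))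
       (Seq (SetIdx (rPow K) (IAdd (IVar (rPow K)) (IVar (rPow K))))
         (SetIdx (rLev K) (IAdd (IVar (rLev K)) (IConst 1))))))))"

text \<open>The charges go straight into array \<open>1\<close>, where \<open>A\<close> expects its
  values. \<open>rLev\<close> holds \<open>m + 1\<close>, so the inner loop covers the levels up to
  and including \<open>m\<close>.\<close>

definition weights_prog :: "nat \<Rightarrow> com" where
  "weights_prog K = For (rJ K) (IVar (rDim K))
     (Seq (Cond (RLess (RCell (aThr K) (IConst 0))
             (RMul (RCell (aVal K) (IVar (rJ K))) (RCell (aPhi K) (IConst 0))))
           (SetCell 1 (IVar (rJ K))
             (RMul (RCell (aVal K) (IVar (rJ K))) (RCell (aPhi K) (IConst 0)))) Skip)
       (For (rL K) (IVar (rLev K))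
         (Cond (RLess (RCell (aThr K) (IConst 0))
             (RMul (RCell (aVal K) (IVar (rJ K))) (RCell (aPhi K) (IVar (rL K)))))
           (SetCell 1 (IVar (rJ K)) (RAdd (RCell 1 (IVar (rJ K)))
             (RDiv (RMul (RCell (aThr K) (IConst 0)) (RConst 2)) (RCell (aPow K) (IVar (rL K)))))) Skip)))"

definition setup_prog :: "nat \<Rightarrow> com" where
  "setup_prog K = Seq (reset (K + 3))
     (Seq (SetIdx 0 (IVar (rLen K)))
     (Seq (SetIdx 1 (IVar (rDim K)))
     (Seq (Copy (rJ K) (rLen K) (aInst K) 0)
     (Seq (SetCell (aThr K) (IConst 0)
            (RMul (RCell (aVal K) (IVar (rE K))) (RCell (aPhi K) (IVar (rI K)))))
       (weights_prog K)))))"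

text \<open>Only \<open><\<close> is available on reals, so a zero cell is recognised by two negated
  comparisons. Ties replace the incumbent, because the first candidate may have exactly the initial
  value \<open>f v\<close>.\<close>

definition compare_prog :: "nat \<Rightarrow> com" where
  "compare_prog K = Seq (Fresh (aQuery K))
     (Seq (For (rJ K) (IVar (rDim K))
       (Cond (BAnd (BNot (RLess (RCell 2 (IVar (rJ K))) (RConst 0)))
                   (BNot (RLess (RConst 0) (RCell 2 (IVar (rJ K)))))) Skip
         (SetCell (aQuery K) (IVar (rJ K)) (RCell (aVal K) (IVar (rJ K))))))
     (Seq (Query (aCur K) (IConst 0) (aQuery K))
       (Cond (RLess (RCell (aOpt K) (IConst 0)) (RCell (aCur K) (IConst 0))) Skip
         (Seq (SetCell (aOpt K) (IConst 0) (RCell (aCur K) (IConst 0)))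
           (Copy (rJ K) (rDim K) 2 (aBest K))))))"

text \<open>The outer limit \<open>rDim + 1\<close> includes the index \<open>n\<close>, where the
  value array is zero, and so yields the threshold \<open>0\<close>.\<close>

definition minnorm_prog :: "nat \<Rightarrow> com \<Rightarrow> com" where
  "minnorm_prog K A =
     Seq (SetIdx (rLen K) (IVar 0))
     (Seq (SetIdx (rDim K) (IVar 1))
     (Seq (Copy (rJ K) (rLen K) 0 (aInst K))
     (Seq (Copy (rJ K) (rDim K) 1 (aVal K))
     (Seq (levels_prog K)
     (Seq (Query (aOpt K) (IConst 0) (aVal K))
     (Seq (For (rE K) (IAdd (IVar (rDim K)) (IConst 1))
       (For (rI K) (IVar (rLev K))
         (Seq (setup_prog K) (Seq A (compare_prog K)))))
     (Seq (Fresh 2)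
       (Copy (rJ K) (rDim K) (aBest K) 2))))))))"

text \<open>The condition on \<open>m\<close> says \<open>m = ceiling (log 2 n)\<close> in the form
  in which the loop test of \<open>levels_prog\<close> meets it. \<open>TA\<close> bounds all calls
  of \<open>A\<close> at once, since they differ only in the weights.\<close>

locale minnorm_run = sym_mono_norm n f for n f +
  fixes K :: nat and A :: com and x :: "real list" and v :: "nat \<Rightarrow> real" and m :: nat
    and F :: "nat set set" and a :: real and TA :: nat
  assumes A_oracle_free: "oracle_free A" and A_bound: "com_bound A \<le> K"
    and v: "v \<in> nonneg_vecs n"
    and F: "F \<subseteq> Pow {..<n}"
    and m: "\<And>i. 2 ^ i < 2 * n \<longleftrightarrow> i \<le> m"
    and A_run: "\<And>w. w \<in> nonneg_vecs n \<Longrightarrow> \<exists>t s'. exec no_oracle A (input x n w) t s' \<and> t \<le> TA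
       \<and> (F \<noteq> {} \<longrightarrow> approx_minimizer F (\<lambda>S. \<Sum>e\<in>S. w e) a (out_set n s'))"
begin

section \<open>Correctness and running time of the program pieces\<close>

abbreviation "oracle \<equiv> value_oracle n f"

text \<open>The data shared by all candidates. They lie at \<open>K + 3\<close> or later, out of
  reach of \<open>A\<close>.\<close>

definition env :: "ram_state \<Rightarrow> bool" where
  "env s \<longleftrightarrow> idx s (rLen K) = length x \<and> idx s (rDim K) = n \<and> idx s (rLev K) = Suc m
     \<and> arr s (aInst K) = (\<lambda>i. if i < length x then x ! i else 0) \<and> arr s (aVal K) = v
     \<and> (\<forall>l\<le>m. arr s (aPhi K) l = phi (2 ^ l) \<and> arr s (aPow K) l = 2 ^ l)"

lemma env_frame:
  assumes "env s" "frame c s s'"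
    "rLen K \<notin> writes_idx c" "rDim K \<notin> writes_idx c" "rLev K \<notin> writes_idx c"
    "aInst K \<notin> writes_arr c" "aVal K \<notin> writes_arr c" "aPhi K \<notin> writes_arr c" "aPow K \<notin> writes_arr c"
  shows "env s'"
  using assms by (simp add: env_def frame_def)

lemma oracle_initial_segment: "oracle (\<lambda>l. if l < k then 1 else 0) = phi k"
proof -
  have "restrict_vec (\<lambda>l. if l < k then 1 else 0) {..<n} = ones {..<min k n}"
    by (auto simp: restrict_vec_def)
  then show ?thesis by (simp add: value_oracle_def phi_def)
qed

lemma runs_levels:
  assumes "idx s (rDim K) = n" "idx s (rLev K) = 0" "arr s (aQuery K) = (\<lambda>_. 0)"
  shows "runs oracle (levels_prog K) (Suc m * (6 * n + 7) + 2)
    (\<lambda>s'. idx s' (rLev K) = Suc m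
       \<and> (\<forall>l\<le>m. arr s' (aPhi K) l = phi (2 ^ l) \<and> arr s' (aPow K) l = 2 ^ l)) s"
proof -
  \<comment> \<open>Zeros are demanded only from \<open>2 ^ i\<close> on: round \<open>i\<close>
    overwrites all earlier cells of the query array with ones.\<close>
  let ?I = "\<lambda>i s'. idx s' (rDim K) = n \<and> idx s' (rLev K) = i \<and> idx s' (rPow K) = 2 ^ i
     \<and> (\<forall>l\<ge>2 ^ i. arr s' (aQuery K) l = 0)
     \<and> (\<forall>l<i. arr s' (aPhi K) l = phi (2 ^ l) \<and> arr s' (aPow K) l = 2 ^ l)"
  let ?fill = "For (rJ K) (IVar (rPow K)) (SetCell (aQuery K) (IVar (rJ K)) (RConst 1))"
  have fill: "runs oracle ?fill (6 * n + 2)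
      (\<lambda>s'. arr s' (aQuery K) = (\<lambda>l. if l < 2 ^ i then 1 else 0)) s"
    if "?I i s" "i \<le> m" for i s
  proof -
    let ?J = "\<lambda>j s'. idx s' (rPow K) = 2 ^ i
        \<and> arr s' (aQuery K) = (\<lambda>l. if l < j then 1 else arr s (aQuery K) l)"
    have "runs oracle ?fill (2 ^ i * (1 + 2) + 2)
      (?J (2 ^ i)) s"
      by (rule runs_For[where I = ?J]; (rule runs_SetCell)?)
        (use that(1) in \<open>auto simp: less_Suc_eq fun_eq_iff\<close>)
    \<comment> \<open>The loop test itself keeps the cost \<open>3 * 2 ^ i\<close> of the filling
      below \<open>6 * n\<close>.\<close>
    moreover have "(2::nat) ^ i < 2 * n" using m that(2) by blast
    ultimately show ?thesis
      by (elim runs_mono) (use that(1) in \<open>auto simp: fun_eq_iff\<close>)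
  qed
  have "runs oracle (levels_prog K) (1 + (Suc m * (((6 * n + 2) + (1 + (1 + (1 + 1)))) + 1) + 1))
      (?I (Suc m)) s"
    unfolding levels_prog_def
  proof (rule runs_Seq_wp, rule runs_SetIdx, rule runs_Loop[where I = ?I])
    fix i :: nat and s :: ram_state assume i: "i < Suc m" and I: "?I i s"
    show "bval (ILess (IVar (rPow K)) (IAdd (IVar (rDim K)) (IVar (rDim K)))) s \<and>
      runs oracle (Seq ?fill
       (Seq (Query (aPhi K) (IVar (rLev K)) (aQuery K))
       (Seq (SetCell (aPow K) (IVar (rLev K)) (RIdx (IVar (rPow K))))
       (Seq (SetIdx (rPow K) (IAdd (IVar (rPow K)) (IVar (rPow K))))
         (SetIdx (rLev K) (IAdd (IVar (rLev K)) (IConst 1)))))))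
       ((6 * n + 2) + (1 + (1 + (1 + 1)))) (?I (Suc i)) s"
    proof
      show "bval (ILess (IVar (rPow K)) (IAdd (IVar (rDim K)) (IVar (rDim K)))) s"
        using I i m[of i] by simp
    next
      show "runs oracle (Seq ?fill
       (Seq (Query (aPhi K) (IVar (rLev K)) (aQuery K))
       (Seq (SetCell (aPow K) (IVar (rLev K)) (RIdx (IVar (rPow K))))
       (Seq (SetIdx (rPow K) (IAdd (IVar (rPow K)) (IVar (rPow K))))
         (SetIdx (rLev K) (IAdd (IVar (rLev K)) (IConst 1)))))))
       ((6 * n + 2) + (1 + (1 + (1 + 1)))) (?I (Suc i)) s"
      proof (rule runs_Seq_wp, rule runs_conseq, rule fill[OF I])
        show "i \<le> m" using i by simp
      next
        fix s' assume s': "arr s' (aQuery K) = (\<lambda>l. if l < 2 ^ i then 1 else 0)"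
          and fr: "frame ?fill s s'"
        have s'_eq: "idx s' (rDim K) = n" "idx s' (rLev K) = i" "idx s' (rPow K) = 2 ^ i"
          "\<And>l. l < i \<Longrightarrow> arr s' (aPhi K) l = phi (2 ^ l)" "\<And>l. l < i \<Longrightarrow> arr s' (aPow K) l = 2 ^ l"
          using I frame_idx[OF fr] frame_arr[OF fr] by simp_all
        show "runs oracle (Seq (Query (aPhi K) (IVar (rLev K)) (aQuery K))
          (Seq (SetCell (aPow K) (IVar (rLev K)) (RIdx (IVar (rPow K))))
          (Seq (SetIdx (rPow K) (IAdd (IVar (rPow K)) (IVar (rPow K))))
          (SetIdx (rLev K) (IAdd (IVar (rLev K)) (IConst 1)))))) (1 + (1 + (1 + 1))) (?I (Suc i)) s'"
          by (rule runs_Seq_wp, rule runs_Query, rule runs_Seq_wp, rule runs_SetCell,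
              rule runs_Seq_wp, rule runs_SetIdx, rule runs_SetIdx)
            (use s' s'_eq in \<open>auto simp: oracle_initial_segment less_Suc_eq\<close>)
      qed
    qed
  qed (use assms m[of "Suc m"] in auto)
  then show ?thesis by (rule runs_mono) (auto simp: less_Suc_eq_le algebra_simps)
qed

lemma runs_weights:
  assumes "env s" "arr s (aThr K) 0 = \<tau>" "0 \<le> \<tau>" "arr s 1 = (\<lambda>_. 0)"
  shows "runs oracle (weights_prog K) (n * (4 * m + 10) + 2)
    (\<lambda>s'. arr s' 1 = weight v m \<tau>) s"
proof -
  let ?e = "\<lambda>s. env s \<and> arr s (aThr K) 0 = \<tau>"
  let ?base = "\<lambda>j. if \<tau> < v j * phi 1 then v j * phi 1 else 0"
  let ?I = "\<lambda>j s'. ?e s' \<and> arr s' 1 = (\<lambda>e. if e < j then weight v m \<tau> e else 0)"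
  \<comment> \<open>Inside the inner loop entry \<open>j\<close> is a partial weight: the first
    summand and the levels below \<open>i\<close>. If the first assignment is skipped, the entry is
    \<open>0\<close> because array \<open>1\<close> was cleared.\<close>
  let ?J = "\<lambda>j i s'. ?e s' \<and> idx s' (rJ K) = j \<and> arr s' 1 = (\<lambda>e. if e < j then weight v m \<tau> e
      else if e = j then ?base j + (\<Sum>l<i. if \<tau> < v j * phi (2 ^ l) then \<tau> * 2 / 2 ^ l else 0)
      else 0)"
  have env0: "arr s (aPhi K) 0 = phi 1" if "env s" for s :: ram_state
    using that by (auto simp: env_def)
  have "runs oracle (weights_prog K) (n * (((1 + 1) + (Suc m * ((1 + 1) + 2) + 2)) + 2) + 2) (?I n) s"
    unfolding weights_prog_def
  proof (rule runs_For[where I = ?I])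
    fix j :: nat and s :: ram_state assume j: "j < n" and I: "?I j s" "idx s (rJ K) = j"
    show "runs oracle (Seq (Cond (RLess (RCell (aThr K) (IConst 0))
             (RMul (RCell (aVal K) (IVar (rJ K))) (RCell (aPhi K) (IConst 0))))
           (SetCell 1 (IVar (rJ K))
             (RMul (RCell (aVal K) (IVar (rJ K))) (RCell (aPhi K) (IConst 0)))) Skip)
       (For (rL K) (IVar (rLev K))
         (Cond (RLess (RCell (aThr K) (IConst 0))
             (RMul (RCell (aVal K) (IVar (rJ K))) (RCell (aPhi K) (IVar (rL K)))))
           (SetCell 1 (IVar (rJ K)) (RAdd (RCell 1 (IVar (rJ K)))
             (RDiv (RMul (RCell (aThr K) (IConst 0)) (RConst 2)) (RCell (aPow K) (IVar (rL K)))))) Skip)))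
       ((1 + 1) + (Suc m * ((1 + 1) + 2) + 2)) (?I (Suc j)) s"
    proof (rule runs_Seq[where R = "?J j 0"], rule runs_Cond; (rule runs_SetCell runs_Skip)?)
      show "?J j 0 (set_cell 1 (ival (IVar (rJ K)) s)
        (rval (RMul (RCell (aVal K) (IVar (rJ K))) (RCell (aPhi K) (IConst 0))) s) s)"
        if "bval (RLess (RCell (aThr K) (IConst 0))
             (RMul (RCell (aVal K) (IVar (rJ K))) (RCell (aPhi K) (IConst 0)))) s"
        using that I by (auto simp: env_def fun_eq_iff)
      show "?J j 0 s"
        if "\<not> bval (RLess (RCell (aThr K) (IConst 0))
             (RMul (RCell (aVal K) (IVar (rJ K))) (RCell (aPhi K) (IConst 0)))) s"
        using that I by (auto simp: env_def fun_eq_iff)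
      fix s' assume "?J j 0 s'"
      then have "runs oracle (For (rL K) (IVar (rLev K))
         (Cond (RLess (RCell (aThr K) (IConst 0))
             (RMul (RCell (aVal K) (IVar (rJ K))) (RCell (aPhi K) (IVar (rL K)))))
           (SetCell 1 (IVar (rJ K)) (RAdd (RCell 1 (IVar (rJ K)))
             (RDiv (RMul (RCell (aThr K) (IConst 0)) (RConst 2)) (RCell (aPow K) (IVar (rL K)))))) Skip))
        (Suc m * ((1 + 1) + 2) + 2) (?J j (Suc m)) s'"
        by (intro runs_For[where I = "?J j"] runs_Cond runs_SetCell runs_Skip)
          (auto simp: env_def fun_eq_iff)
      then show "runs oracle (For (rL K) (IVar (rLev K))
         (Cond (RLess (RCell (aThr K) (IConst 0))
             (RMul (RCell (aVal K) (IVar (rJ K))) (RCell (aPhi K) (IVar (rL K)))))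
           (SetCell 1 (IVar (rJ K)) (RAdd (RCell 1 (IVar (rJ K)))
             (RDiv (RMul (RCell (aThr K) (IConst 0)) (RConst 2)) (RCell (aPow K) (IVar (rL K)))))) Skip))
        (Suc m * ((1 + 1) + 2) + 2) (?I (Suc j)) s'"
        by (rule runs_mono) (auto simp: weight_def lessThan_Suc_atMost fun_eq_iff less_Suc_eq)
    qed
  qed (use assms in \<open>auto simp: env_def\<close>)
  \<comment> \<open>Only \<open>n\<close> cells were filled, but the weights vanish beyond
    them.\<close>
  moreover have "(\<lambda>e. if e < n then weight v m \<tau> e else 0) = weight v m \<tau>"
    using weight_nonneg_vecs[OF v assms(3)] by (auto simp: nonneg_vecs_def vecs_def)
  ultimately show ?thesis by (elim runs_mono) (auto simp: algebra_simps)
qed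

text \<open>Agreement up to \<open>K + 3\<close> covers everything \<open>A\<close> can access and
  also the input and output locations \<open>0\<close>, \<open>1\<close>, \<open>2\<close>, some of
  which \<open>A\<close> might not mention.\<close>

lemma runs_setup:
  assumes "env s" "idx s (rE K) = e" "idx s (rI K) = i" "i \<le> m" "\<tau> = v e * phi (2 ^ i)"
  shows "runs oracle (setup_prog K) (2 * K + 3 * length x + n * (4 * m + 10) + 14)
    (\<lambda>s'. agree (K + 3) (input x n (weight v m \<tau>)) s') s"
proof -
  have \<tau>: "0 \<le> \<tau>" using v phi_nonneg assms(5) by (simp add: nonneg_vecs_def)
  let ?T = "1 + (1 + ((length x * 3 + 2) + (1 + (n * (4 * m + 10) + 2))))"
  have "runs oracle (setup_prog K) ((2 * (K + 3) + 1) + ?T)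
    (\<lambda>s'. agree (K + 3) (input x n (weight v m \<tau>)) s') s"
    unfolding setup_prog_def
  proof (rule runs_Seq_wp, rule runs_conseq, rule runs_reset)
    fix s1 assume s1: "\<forall>i<K + 3. idx s1 i = 0 \<and> arr s1 i = (\<lambda>_. 0)"
      and fr1: "frame (reset (K + 3)) s s1"
    have env1: "env s1" by (rule env_frame[OF assms(1) fr1]) auto
    have e1: "idx s1 (rE K) = e" "idx s1 (rI K) = i"
      using assms(2,3) frame_idx[OF fr1] by auto
    define s2 where "s2 = set_idx 1 n (set_idx 0 (length x) s1)"
    have s2: "env s2" "idx s2 (rE K) = e" "idx s2 (rI K) = i"
      using env1 e1 by (auto simp: s2_def env_def)
    have low2: "idx s2 j = ((\<lambda>_. 0)(0 := length x, 1 := n)) j" "arr s2 j = (\<lambda>_. 0)"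
      if "j < K + 3" for j
      using s1 that by (auto simp: s2_def)
    have "runs oracle (Seq (Copy (rJ K) (rLen K) (aInst K) 0)
       (Seq (SetCell (aThr K) (IConst 0)
            (RMul (RCell (aVal K) (IVar (rE K))) (RCell (aPhi K) (IVar (rI K)))))
       (weights_prog K))) ((idx s2 (rLen K) * 3 + 2) + (1 + (n * (4 * m + 10) + 2)))
      (\<lambda>s'. agree (K + 3) (input x n (weight v m \<tau>)) s') s2"
    proof (rule runs_Seq_wp, rule runs_conseq, rule runs_Copy)
      fix s3 assume s3: "arr s3 0 =
          (\<lambda>i. if i < idx s2 (rLen K) then arr s2 (aInst K) i else arr s2 0 i)"
        and fr3: "frame (Copy (rJ K) (rLen K) (aInst K) 0) s2 s3"
      have env3: "env s3" by (rule env_frame[OF s2(1) fr3]) auto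
      have e3: "idx s3 (rE K) = e" "idx s3 (rI K) = i"
        using s2(2,3) frame_idx[OF fr3] by auto
      have arr3: "arr s3 0 = (\<lambda>i. if i < length x then x ! i else 0)"
        using s3 s2(1) low2(2)[of 0] by (auto simp: env_def)
      have low3: "idx s3 j = ((\<lambda>_. 0)(0 := length x, 1 := n)) j"
        "0 < j \<Longrightarrow> arr s3 j = (\<lambda>_. 0)" if "j < K + 3" for j
        using low2[OF that] that frame_idx[OF fr3, of j] frame_arr[OF fr3, of j] by simp_all
      show "runs oracle (Seq (SetCell (aThr K) (IConst 0)
            (RMul (RCell (aVal K) (IVar (rE K))) (RCell (aPhi K) (IVar (rI K)))))
         (weights_prog K)) (1 + (n * (4 * m + 10) + 2))
        (\<lambda>s'. agree (K + 3) (input x n (weight v m \<tau>)) s') s3"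
      proof (rule runs_Seq_wp, rule runs_SetCell, rule runs_conseq, rule runs_weights)
        let ?s = "set_cell (aThr K) (ival (IConst 0) s3)
          (rval (RMul (RCell (aVal K) (IVar (rE K))) (RCell (aPhi K) (IVar (rI K)))) s3) s3"
        show "env ?s" using env3 by (simp add: env_def)
        show "arr ?s (aThr K) 0 = \<tau>" using env3 e3 assms(4,5) by (simp add: env_def)
        show "arr ?s 1 = (\<lambda>_. 0)" using low3(2)[of 1] by simp
        fix s4 assume s4: "arr s4 1 = weight v m \<tau>" and fr4: "frame (weights_prog K) ?s s4"
        have low4: "idx s4 j = idx s3 j" "j \<noteq> 1 \<Longrightarrow> arr s4 j = arr s3 j" if "j < K + 3" for j
          using that frame_idx[OF fr4, of j] frame_arr[OF fr4, of j] by (simp_all add: weights_prog_def)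
        have "idx s4 j = idx (input x n (weight v m \<tau>)) j
            \<and> arr s4 j = arr (input x n (weight v m \<tau>)) j" if "j < K + 3" for j
          using low4[OF that] low3[OF that] s4 arr3 by (auto simp: input_def)
        then show "agree (K + 3) (input x n (weight v m \<tau>)) s4" by (simp add: agree_def)
      qed (rule \<tau>)
    qed simp_all
    moreover have "idx s2 (rLen K) = length x" using s2(1) by (simp add: env_def)
    ultimately show "runs oracle (Seq (SetIdx 0 (IVar (rLen K)))
       (Seq (SetIdx 1 (IVar (rDim K)))
       (Seq (Copy (rJ K) (rLen K) (aInst K) 0)
       (Seq (SetCell (aThr K) (IConst 0)
            (RMul (RCell (aVal K) (IVar (rE K))) (RCell (aPhi K) (IVar (rI K)))))
       (weights_prog K))))) ?T
      (\<lambda>s'. agree (K + 3) (input x n (weight v m \<tau>)) s') s1"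
      using env1
      by (rule_tac runs_Seq_wp, rule_tac runs_SetIdx, rule_tac runs_Seq_wp, rule_tac runs_SetIdx)
        (simp add: s2_def env_def)
  qed
  then show ?thesis by (rule runs_mono) auto
qed

text \<open>Lockstep execution carries the guarantee from the clean input state without oracle to
  the present state with the oracle of \<open>f\<close>; agreement on array \<open>2\<close>
  transfers the returned set.\<close>

lemma runs_A:
  assumes "w \<in> nonneg_vecs n" "agree (K + 3) (input x n w) s"
  shows "runs oracle A TA
    (\<lambda>s'. F \<noteq> {} \<longrightarrow> approx_minimizer F (\<lambda>S. \<Sum>e\<in>S. w e) a (out_set n s')) s"
proof -
  obtain t s' where s': "exec no_oracle A (input x n w) t s'" "t \<le> TA"
    "F \<noteq> {} \<longrightarrow> approx_minimizer F (\<lambda>S. \<Sum>e\<in>S. w e) a (out_set n s')"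
    using A_run[OF assms(1)] by blast
  obtain u' where u': "exec oracle A s t u'" "agree (K + 3) s' u'"
    using exec_agree[OF s'(1) A_oracle_free _ assms(2)] A_bound by force
  have "out_set n u' = out_set n s'" using u'(2) by (simp add: agree_def out_set_def)
  then show ?thesis
    using u'(1) s'(2,3) unfolding runs_def by (intro exI[of _ t] exI[of _ u']) simp
qed

definition best :: "ram_state \<Rightarrow> real" where
  "best s = arr s (aOpt K) 0"

definition best_set :: "ram_state \<Rightarrow> nat set" where
  "best_set s = {e. e < n \<and> arr s (aBest K) e \<noteq> 0}"

lemma runs_compare:
  assumes "env s" "val = f (restrict_vec v (out_set n s))"
  shows "runs oracle (compare_prog K) (7 * n + 9)
    (\<lambda>s'. if best s < val then best s' = best s \<and> best_set s' = best_set s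
         else best s' = val \<and> best_set s' = out_set n s) s"
    (is "runs _ _ _ ?Q s")
proof -
  let ?g = "\<lambda>l. if arr s 2 l \<noteq> 0 then v l else 0"
  let ?I = "\<lambda>j s'. env s' \<and> arr s' (aOpt K) = arr s (aOpt K) \<and> arr s' (aBest K) = arr s (aBest K)
    \<and> arr s' 2 = arr s 2 \<and> arr s' (aQuery K) = (\<lambda>l. if l < j then ?g l else 0)"
  have val: "oracle (\<lambda>l. if l < n then ?g l else 0) = val"
  proof -
    have "restrict_vec (\<lambda>l. if l < n then ?g l else 0) {..<n} = restrict_vec v (out_set n s)"
      by (auto simp: restrict_vec_def out_set_def)
    then show ?thesis by (simp add: value_oracle_def assms(2))
  qed
  have "runs oracle (compare_prog K)
    (1 + ((n * ((1 + 1) + 2) + 2) + (1 + ((1 + (n * 3 + 2)) + 1)))) ?Q s"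
    unfolding compare_prog_def
  proof (rule runs_Seq_wp, rule runs_Fresh, rule runs_Seq_wp, rule runs_mono[OF _ order_refl],
      rule runs_For[where I = ?I])
    fix j and s' :: ram_state assume "j < n" "?I j s'" "idx s' (rJ K) = j"
    then show "runs oracle (Cond (BAnd (BNot (RLess (RCell 2 (IVar (rJ K))) (RConst 0)))
                   (BNot (RLess (RConst 0) (RCell 2 (IVar (rJ K)))))) Skip
         (SetCell (aQuery K) (IVar (rJ K)) (RCell (aVal K) (IVar (rJ K))))) (1 + 1) (?I (Suc j)) s'"
      by (intro runs_Cond runs_Skip runs_SetCell) (auto simp: env_def fun_eq_iff less_Suc_eq)
  next
    fix s1 assume I: "?I n s1"
    let ?s2 = "set_cell (aCur K) (ival (IConst 0) s1) (oracle (arr s1 (aQuery K))) s1"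
    have s2: "arr ?s2 (aCur K) 0 = val" "arr ?s2 (aOpt K) = arr s (aOpt K)"
      "arr ?s2 (aBest K) = arr s (aBest K)" "arr ?s2 2 = arr s 2" "idx ?s2 (rDim K) = n"
      using I val by (simp_all add: env_def)
    show "runs oracle (Seq (Query (aCur K) (IConst 0) (aQuery K))
       (Cond (RLess (RCell (aOpt K) (IConst 0)) (RCell (aCur K) (IConst 0))) Skip
         (Seq (SetCell (aOpt K) (IConst 0) (RCell (aCur K) (IConst 0)))
           (Copy (rJ K) (rDim K) 2 (aBest K))))) (1 + ((1 + (n * 3 + 2)) + 1)) ?Q s1"
    proof (rule runs_Seq_wp, rule runs_Query, rule runs_Cond)
      assume "bval (RLess (RCell (aOpt K) (IConst 0)) (RCell (aCur K) (IConst 0))) ?s2"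
      then have "best s < val" using s2 by (simp add: best_def)
      then have "?Q ?s2" using s2 by (simp add: best_def best_set_def)
      then show "runs oracle Skip (1 + (n * 3 + 2)) ?Q ?s2"
        by (intro runs_mono[OF runs_Skip[where Q = ?Q]]) auto
    next
      assume "\<not> bval (RLess (RCell (aOpt K) (IConst 0)) (RCell (aCur K) (IConst 0))) ?s2"
      then have nl: "\<not> best s < val" using s2 by (simp add: best_def)
      let ?s3 = "set_cell (aOpt K) (ival (IConst 0) ?s2)
        (rval (RCell (aCur K) (IConst 0)) ?s2) ?s2"
      have s3: "idx ?s3 (rDim K) = n" "arr ?s3 (aOpt K) 0 = val" "arr ?s3 2 = arr s 2"
        using s2 by simp_all
      have "runs oracle (Copy (rJ K) (rDim K) 2 (aBest K)) (idx ?s3 (rDim K) * 3 + 2) ?Q ?s3"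
      proof (rule runs_conseq, rule runs_Copy)
        fix s4 assume s4: "arr s4 (aBest K) =
            (\<lambda>i. if i < idx ?s3 (rDim K) then arr ?s3 2 i else arr ?s3 (aBest K) i)"
          and fr: "frame (Copy (rJ K) (rDim K) 2 (aBest K)) ?s3 s4"
        have "arr s4 (aOpt K) = arr ?s3 (aOpt K)" by (rule frame_arr[OF fr]) simp
        then have "best s4 = val" using s3(2) by (simp only: best_def)
        moreover have "best_set s4 = out_set n s"
          unfolding best_set_def out_set_def s4 s3(1,3) by auto
        ultimately show "?Q s4" using nl by simp
      qed simp_all
      then show "runs oracle (Seq (SetCell (aOpt K) (IConst 0) (RCell (aCur K) (IConst 0)))
           (Copy (rJ K) (rDim K) 2 (aBest K))) (1 + (n * 3 + 2)) ?Q ?s2"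
        unfolding s3(1) by (intro runs_Seq_wp runs_SetCell)
    qed
  qed (use assms(1) in \<open>auto simp: env_def\<close>)
  then show ?thesis by (rule runs_mono) auto
qed

text \<open>
  Before the first candidate the best value is \<open>f v\<close>, which no feasible set exceeds, so the first
  candidate always replaces it.
\<close>

definition progress :: "real set \<Rightarrow> ram_state \<Rightarrow> bool" where
  "progress C s \<longleftrightarrow> env s \<and> (F \<noteq> {} \<longrightarrow>
     (\<forall>\<tau>\<in>C. \<exists>S. approx_minimizer F (\<lambda>S. \<Sum>e\<in>S. weight v m \<tau> e) a S \<and> best s \<le> f (restrict_vec v S)) \<and>
     (if C = {} then best s = f v else best_set s \<in> F \<and> best s = f (restrict_vec v (best_set s))))"

lemma progress_env: "progress C s \<Longrightarrow> env s"
  by (simp add: progress_def)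

lemma progress_best_set:
  assumes "progress C s" "C \<noteq> {}" "F \<noteq> {}"
  shows "best_set s \<in> F"
    and "\<tau> \<in> C \<Longrightarrow> \<exists>S. approx_minimizer F (\<lambda>S. \<Sum>e\<in>S. weight v m \<tau> e) a S
      \<and> f (restrict_vec v (best_set s)) \<le> f (restrict_vec v S)"
  using assms by (auto simp: progress_def)

lemma progress_set_idx:
  assumes "progress C s" "j \<noteq> rLen K" "j \<noteq> rDim K" "j \<noteq> rLev K"
  shows "progress C (set_idx j k s)"
proof -
  have "env (set_idx j k s)" using assms by (simp add: progress_def env_def)
  moreover have "best (set_idx j k s) = best s" "best_set (set_idx j k s) = best_set s"
    by (simp_all add: best_def best_set_def)
  ultimately show ?thesis using assms(1) by (simp only: progress_def) blast
qed

lemma norm_restrict_le_norm: "S \<subseteq> {..<n} \<Longrightarrow> f (restrict_vec v S) \<le> f v"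
  using v by (intro norm_mono restrict_vec_nonneg) (auto simp: nonneg_vecs_def restrict_vec_def)

text \<open>\<open>C\<close> collects the thresholds already tried. The best value never increases,
  so the witnesses for earlier thresholds stay valid, and the new one is witnessed by the set just
  returned.\<close>

lemma runs_candidate:
  assumes "progress C s" "idx s (rE K) = e" "idx s (rI K) = i" "i \<le> m"
  shows "runs oracle (Seq (setup_prog K) (Seq A (compare_prog K)))
    (2 * K + 3 * length x + n * (4 * m + 17) + TA + 23)
    (\<lambda>s'. progress (insert (v e * phi (2 ^ i)) C) s' \<and> idx s' (rE K) = e) s"
    (is "runs _ _ _ ?Q s")
proof -
  let ?\<tau> = "v e * phi (2 ^ i)"
  have env: "env s" using assms(1) by (simp add: progress_def)
  have w: "weight v m ?\<tau> \<in> nonneg_vecs n"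
    using v phi_nonneg by (intro weight_nonneg_vecs) (auto simp: nonneg_vecs_def)
  have "runs oracle (Seq (setup_prog K) (Seq A (compare_prog K)))
    ((2 * K + 3 * length x + n * (4 * m + 10) + 14) + (TA + (7 * n + 9))) ?Q s"
  proof (rule runs_Seq_wp, rule runs_conseq, rule runs_setup[OF env assms(2-4) refl])
    fix s1 assume ag: "agree (K + 3) (input x n (weight v m ?\<tau>)) s1"
      and fr1: "frame (setup_prog K) s s1"
    note wr = setup_prog_def weights_prog_def
    have env1: "env s1" by (rule env_frame[OF env fr1]) (simp_all add: wr)
    have s1: "best s1 = best s" "best_set s1 = best_set s" "idx s1 (rE K) = e"
      using frame_arr[OF fr1] frame_idx[OF fr1] assms(2) by (simp_all add: best_def best_set_def wr)
    show "runs oracle (Seq A (compare_prog K)) (TA + (7 * n + 9)) ?Q s1"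
    proof (rule runs_Seq_wp, rule runs_conseq, rule runs_A[OF w ag])
      fix s2 assume am: "F \<noteq> {} \<longrightarrow>
          approx_minimizer F (\<lambda>S. \<Sum>e\<in>S. weight v m ?\<tau> e) a (out_set n s2)"
        and fr2: "frame A s1 s2"
      \<comment> \<open>\<open>A\<close> writes only below \<open>K\<close>, so environment,
        incumbent and loop counters survive the call.\<close>
      have nw: "j \<notin> writes_idx A" "j \<notin> writes_arr A" if "K \<le> j" for j
        using that A_bound writes_less_com_bound[of j A] by auto
      have env2: "env s2" by (rule env_frame[OF env1 fr2]) (simp_all add: nw)
      have s2: "best s2 = best s" "best_set s2 = best_set s" "idx s2 (rE K) = e"
        using frame_arr[OF fr2] frame_idx[OF fr2] s1 by (simp_all add: best_def best_set_def nw)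
      let ?val = "f (restrict_vec v (out_set n s2))"
      show "runs oracle (compare_prog K) (7 * n + 9) ?Q s2"
      proof (rule runs_conseq, rule runs_compare[OF env2 refl])
        fix s3 assume s3: "if best s2 < ?val then best s3 = best s2 \<and> best_set s3 = best_set s2
             else best s3 = ?val \<and> best_set s3 = out_set n s2"
          and fr3: "frame (compare_prog K) s2 s3"
        have env3: "env s3" by (rule env_frame[OF env2 fr3]) (simp_all add: compare_prog_def)
        have e3: "idx s3 (rE K) = e"
          using frame_idx[OF fr3] s2 by (simp add: compare_prog_def)
        have "(\<forall>\<tau>\<in>insert ?\<tau> C. \<exists>S. approx_minimizer F (\<lambda>S. \<Sum>e\<in>S. weight v m \<tau> e) a S
              \<and> best s3 \<le> f (restrict_vec v S))
            \<and> best_set s3 \<in> F \<and> best s3 = f (restrict_vec v (best_set s3))" if ne: "F \<noteq> {}"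
        proof -
          have am': "approx_minimizer F (\<lambda>S. \<Sum>e\<in>S. weight v m ?\<tau> e) a (out_set n s2)"
            using am ne by simp
          have C: "\<exists>S. approx_minimizer F (\<lambda>S. \<Sum>e\<in>S. weight v m \<tau> e) a S
              \<and> best s \<le> f (restrict_vec v S)" if "\<tau> \<in> C" for \<tau>
            using assms(1) ne that by (simp add: progress_def)
          have le: "best s3 \<le> best s" "best s3 \<le> ?val"
            using s3 s2 by (auto split: if_splits)
          have "\<exists>S. approx_minimizer F (\<lambda>S. \<Sum>e\<in>S. weight v m \<tau> e) a S
              \<and> best s3 \<le> f (restrict_vec v S)" if "\<tau> \<in> insert ?\<tau> C" for \<tau>
            using that C am' le by (blast intro: order_trans)
          moreover have "best_set s3 \<in> F \<and> best s3 = f (restrict_vec v (best_set s3))"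
          proof (cases "best s2 < ?val")
            case True
            have "?val \<le> f v" by (rule norm_restrict_le_norm) (auto simp: out_set_def)
            \<comment> \<open>An incumbent strictly better than a value at most \<open>f v\<close>
              cannot be the initial one, so it belongs to a recorded set.\<close>
            then have "C \<noteq> {}" using True s2 assms(1) ne by (auto simp: progress_def)
            then show ?thesis using True s3 s2 assms(1) ne by (simp add: progress_def)
          next
            case False
            then show ?thesis using s3 am' by (simp add: approx_minimizer_def)
          qed
          ultimately show ?thesis by blast
        qed
        then show "?Q s3"
          unfolding progress_def using env3 e3 by (simp only: insert_not_empty if_False) blast
      qed
    qed
  qed
  then show ?thesis by (rule runs_mono) (auto simp: algebra_simps)
qed

section \<open>The loop over all candidates and the whole program\<close>

definition cand_time :: nat where
  "cand_time = 2 * K + 3 * length x + n * (4 * m + 17) + TA + 23"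

lemma runs_candidates:
  assumes "progress {} s"
  shows "runs oracle (For (rE K) (IAdd (IVar (rDim K)) (IConst 1))
       (For (rI K) (IVar (rLev K)) (Seq (setup_prog K) (Seq A (compare_prog K)))))
     (Suc n * ((Suc m * (cand_time + 2) + 2) + 2) + 2)
     (progress {v e * phi (2 ^ i) |e i. e < Suc n \<and> i \<le> m}) s"
proof (rule runs_For[where I = "\<lambda>e. progress {v e' * phi (2 ^ i) |e' i. e' < e \<and> i \<le> m}"])
  fix e :: nat and s :: ram_state
  let ?C = "{v e' * phi (2 ^ i) |e' i. e' < e \<and> i \<le> m}"
  \<comment> \<open>The thresholds tried so far are those of all finished indices and the levels
    below \<open>j\<close> of the current one. The outer counter is recorded because
    \<open>env\<close> leaves it open.\<close>
  let ?I = "\<lambda>j s. progress (?C \<union> {v e * phi (2 ^ i) |i. i < j}) s \<and> idx s (rE K) = e"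
  assume e: "progress ?C s" "idx s (rE K) = e"
  have "runs oracle (For (rI K) (IVar (rLev K)) (Seq (setup_prog K) (Seq A (compare_prog K))))
      (Suc m * (cand_time + 2) + 2) (?I (Suc m)) s"
  proof (rule runs_For[where I = ?I])
    fix j and s :: ram_state assume j: "j < Suc m" "?I j s" "idx s (rI K) = j"
    then have "runs oracle (Seq (setup_prog K) (Seq A (compare_prog K))) cand_time
      (\<lambda>s'. progress (insert (v e * phi (2 ^ j)) (?C \<union> {v e * phi (2 ^ i) |i. i < j})) s'
        \<and> idx s' (rE K) = e) s"
      unfolding cand_time_def by (intro runs_candidate) auto
    moreover have "insert (v e * phi (2 ^ j)) (?C \<union> {v e * phi (2 ^ i) |i. i < j})
      = ?C \<union> {v e * phi (2 ^ i) |i. i < Suc j}"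
      by (auto simp: less_Suc_eq)
    ultimately show "runs oracle (Seq (setup_prog K) (Seq A (compare_prog K))) cand_time
      (?I (Suc j)) s" by simp
  next
    show "rI K \<notin> writes_idx (Seq (setup_prog K) (Seq A (compare_prog K)))"
      using A_bound writes_less_com_bound(1)[of "rI K" A]
      by (auto simp: setup_prog_def weights_prog_def compare_prog_def)
  next
    fix j and s :: ram_state assume "?I j s"
    then have "env s" by (blast intro: progress_env)
    then show "ival (IVar (rLev K)) s = Suc m" by (simp add: env_def)
  next
    fix j k and s :: ram_state assume "?I j s"
    then show "?I j (set_idx (rI K) k s)" by (auto intro: progress_set_idx)
  qed (use e in simp)
  moreover have "?C \<union> {v e * phi (2 ^ i) |i. i < Suc m}
      = {v e' * phi (2 ^ i) |e' i. e' < Suc e \<and> i \<le> m}"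
    unfolding less_Suc_eq[of _ e] less_Suc_eq_le[of _ m] by blast
  ultimately show "runs oracle
      (For (rI K) (IVar (rLev K)) (Seq (setup_prog K) (Seq A (compare_prog K))))
      (Suc m * (cand_time + 2) + 2)
      (progress {v e' * phi (2 ^ i) |e' i. e' < Suc e \<and> i \<le> m}) s"
    by (elim runs_mono) auto
next
  show "rE K \<notin> writes_idx (For (rI K) (IVar (rLev K)) (Seq (setup_prog K) (Seq A (compare_prog K))))"
    using A_bound writes_less_com_bound(1)[of "rE K" A]
    by (auto simp: setup_prog_def weights_prog_def compare_prog_def)
next
  fix j and s :: ram_state
  assume "progress {v e' * phi (2 ^ i) |e' i. e' < j \<and> i \<le> m} s"
  then have "env s" by (rule progress_env)
  then show "ival (IAdd (IVar (rDim K)) (IConst 1)) s = Suc n" by (simp add: env_def)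
qed (use assms in \<open>auto intro: progress_set_idx\<close>)

definition total_time :: nat where
  "total_time = Suc n * (Suc m * (cand_time + 2) + 4) + Suc m * (6 * n + 7) + 3 * length x + 6 * n + 14"

text \<open>The program cannot know which threshold is good. It suffices that its output is, for
  each threshold, no worse than some approximate minimizer for that threshold.\<close>

lemma runs_minnorm:
  "runs oracle (minnorm_prog K A) total_time
    (\<lambda>s'. F \<noteq> {} \<longrightarrow> out_set n s' \<in> F \<and> (\<forall>e\<le>n. \<forall>i\<le>m. \<exists>S.
       approx_minimizer F (\<lambda>S. \<Sum>e'\<in>S. weight v m (v e * phi (2 ^ i)) e') a S
       \<and> f (restrict_vec v (out_set n s')) \<le> f (restrict_vec v S)))
    (input x n v)"
  (is "runs _ _ _ ?Q ?s0")
proof -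
  have v0: "v i = 0" if "n \<le> i" for i
    using v that by (simp add: nonneg_vecs_def vecs_def)
  have fv: "oracle v = f v"
  proof -
    have "restrict_vec v {..<n} = v" using v0 by (auto simp: restrict_vec_def)
    then show ?thesis by (simp add: value_oracle_def)
  qed
  let ?s1 = "set_idx (rDim K) n (set_idx (rLen K) (length x) ?s0)"
  let ?body = "Seq (setup_prog K) (Seq A (compare_prog K))"
  let ?loop = "For (rE K) (IAdd (IVar (rDim K)) (IConst 1)) (For (rI K) (IVar (rLev K)) ?body)"
  let ?tloop = "Suc n * ((Suc m * (cand_time + 2) + 2) + 2) + 2"
  let ?C = "{v e * phi (2 ^ i) |e i. e < Suc n \<and> i \<le> m}"
  let ?p5 = "Seq (Fresh 2) (Copy (rJ K) (rDim K) (aBest K) 2)"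
  let ?p4 = "Seq (Query (aOpt K) (IConst 0) (aVal K)) (Seq ?loop ?p5)"
  let ?p3 = "Seq (levels_prog K) ?p4"
  let ?p2 = "Seq (Copy (rJ K) (rDim K) 1 (aVal K)) ?p3"
  let ?p1 = "Seq (Copy (rJ K) (rLen K) 0 (aInst K)) ?p2"
  let ?t5 = "1 + (n * 3 + 2)"
  let ?t4 = "1 + (?tloop + ?t5)"
  let ?t3 = "(Suc m * (6 * n + 7) + 2) + ?t4"
  let ?t2 = "(n * 3 + 2) + ?t3"
  have p5: "runs oracle ?p5 ?t5 ?Q s" if I: "progress ?C s" for s :: ram_state
  proof -
    let ?s' = "set_arr 2 (\<lambda>_. 0) s"
    have n: "idx ?s' (rDim K) = n" using progress_env[OF I] by (simp add: env_def)
    have "runs oracle (Copy (rJ K) (rDim K) (aBest K) 2) (idx ?s' (rDim K) * 3 + 2) ?Q ?s'"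
    proof (rule runs_conseq, rule runs_Copy)
      fix s'' :: ram_state assume "arr s'' 2 =
        (\<lambda>i. if i < idx ?s' (rDim K) then arr ?s' (aBest K) i else arr ?s' 2 i)"
      then have out: "out_set n s'' = best_set s"
        using n by (auto simp: out_set_def best_set_def)
      show "?Q s''"
      proof
        assume ne: "F \<noteq> {}"
        \<comment> \<open>At least one candidate was tried, so the incumbent is a feasible set and
          not just the initial value.\<close>
        have "v 0 * phi (2 ^ 0) \<in> ?C" by blast
        then have "?C \<noteq> {}" by blast
        note b = progress_best_set[OF I this ne]
        have "v e * phi (2 ^ i) \<in> ?C" if "e \<le> n" "i \<le> m" for e i
          using that by (auto simp: less_Suc_eq_le)
        then show "out_set n s'' \<in> F \<and> (\<forall>e\<le>n. \<forall>i\<le>m. \<exists>S.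
            approx_minimizer F (\<lambda>S. \<Sum>e'\<in>S. weight v m (v e * phi (2 ^ i)) e') a S
            \<and> f (restrict_vec v (out_set n s'')) \<le> f (restrict_vec v S))"
          unfolding out using b by blast
      qed
    qed simp_all
    then show ?thesis unfolding n by (rule runs_Seq_wp[OF runs_Fresh])
  qed
  have p4: "runs oracle ?p4 ?t4 ?Q s" if "env s" for s :: ram_state
  proof (rule runs_Seq_wp, rule runs_Query, rule runs_Seq, rule runs_candidates)
    show "progress {} (set_cell (aOpt K) (ival (IConst 0) s) (oracle (arr s (aVal K))) s)"
      using that fv by (simp add: progress_def env_def best_def)
  qed (rule p5)
  have p3: "runs oracle ?p3 ?t3 ?Q s"
    if s: "idx s (rLen K) = length x" "idx s (rDim K) = n" "idx s (rLev K) = 0"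
      "arr s (aInst K) = (\<lambda>i. if i < length x then x ! i else 0)" "arr s (aVal K) = v"
      "arr s (aQuery K) = (\<lambda>_. 0)" for s :: ram_state
  proof (rule runs_Seq_wp, rule runs_conseq, rule runs_levels)
    fix s' assume s': "idx s' (rLev K) = Suc m \<and>
        (\<forall>l\<le>m. arr s' (aPhi K) l = phi (2 ^ l) \<and> arr s' (aPow K) l = 2 ^ l)"
      and fr: "frame (levels_prog K) s s'"
    have "env s'"
      using s s' frame_idx[OF fr] frame_arr[OF fr] by (simp add: env_def levels_prog_def)
    then show "runs oracle ?p4 ?t4 ?Q s'" by (rule p4)
  qed (use s in simp_all)
  have p2: "runs oracle ?p2 ?t2 ?Q s"
    if s: "idx s (rLen K) = length x" "idx s (rDim K) = n" "idx s (rLev K) = 0"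
      "arr s (aInst K) = (\<lambda>i. if i < length x then x ! i else 0)" "arr s 1 = v"
      "arr s (aQuery K) = (\<lambda>_. 0)" "arr s (aVal K) = (\<lambda>_. 0)" for s :: ram_state
  proof -
    have "runs oracle ?p2 ((idx s (rDim K) * 3 + 2) + ?t3) ?Q s"
    proof (rule runs_Seq_wp, rule runs_conseq, rule runs_Copy)
      fix s' assume s': "arr s' (aVal K) =
          (\<lambda>i. if i < idx s (rDim K) then arr s 1 i else arr s (aVal K) i)"
        and fr: "frame (Copy (rJ K) (rDim K) 1 (aVal K)) s s'"
      have "arr s' (aVal K) = v" using s s' v0 by (auto simp: fun_eq_iff)
      then show "runs oracle ?p3 ?t3 ?Q s'"
        using s frame_idx[OF fr] frame_arr[OF fr] by (intro p3) simp_all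
    qed simp_all
    then show ?thesis unfolding s(2) .
  qed
  have s1: "idx ?s1 (rLen K) = length x" by simp
  have "runs oracle ?p1 ((idx ?s1 (rLen K) * 3 + 2) + ?t2) ?Q ?s1"
  proof (rule runs_Seq_wp, rule runs_conseq, rule runs_Copy)
    fix s' assume s': "arr s' (aInst K) =
        (\<lambda>i. if i < idx ?s1 (rLen K) then arr ?s1 0 i else arr ?s1 (aInst K) i)"
      and fr: "frame (Copy (rJ K) (rLen K) 0 (aInst K)) ?s1 s'"
    have "arr s' (aInst K) = (\<lambda>i. if i < length x then x ! i else 0)"
      using s' by (auto simp: fun_eq_iff input_def)
    then show "runs oracle ?p2 ?t2 ?Q s'"
      using frame_idx[OF fr] frame_arr[OF fr] by (intro p2) (simp_all add: input_def)
  qed simp_all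
  then have "runs oracle (minnorm_prog K A) (1 + (1 + ((length x * 3 + 2) + ?t2))) ?Q ?s0"
    unfolding minnorm_prog_def s1
    by (rule_tac runs_Seq_wp, rule_tac runs_SetIdx, rule_tac runs_Seq_wp, rule_tac runs_SetIdx)
      (simp add: input_def)
  then show ?thesis by (rule runs_mono) (auto simp: total_time_def algebra_simps)
qed

end

text \<open>This is \<open>total_time\<close> with \<open>n\<close> and \<open>length x\<close>
  replaced by the input size and \<open>m\<close> by twice the input size;
  \<open>[:2 * K + 25, 20, 8:] + p\<close> bounds \<open>cand_time + 2\<close>.\<close>

definition minnorm_time_poly :: "nat \<Rightarrow> nat poly \<Rightarrow> nat poly" where
  "minnorm_time_poly K p =
     [:1, 1:] * ([:1, 2:] * ([:2 * K + 25, 20, 8:] + p) + [:4:]) + [:1, 2:] * [:7, 6:] + [:14, 9:]"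

section \<open>Polynomial running time and approximation ratio\<close>

theorem theorem4p5:
  fixes P :: comb_problem and \<alpha> :: "nat \<Rightarrow> real" and \<epsilon> :: real
  assumes "comb_problem P"
    and "\<forall>x\<in>instances P. 2 \<le> gsize P x"
    and "\<exists>D. poly_time_membership_test P D"
    and "\<forall>n. 1 \<le> \<alpha> n"
    and "\<exists>A. poly_time_min_sum_approx P \<alpha> A"
    and "0 < \<epsilon>"
  shows "\<exists>B. poly_time_min_norm_approx P
           (\<lambda>n. 4 * \<alpha> n * real_of_int \<lceil>log 2 (real n)\<rceil> + \<epsilon>) B"
proof -
  obtain A where A: "poly_time_min_sum_approx P \<alpha> A" using assms(5) by blast
  then obtain p :: "nat poly" where p: "\<And>x v. x \<in> instances P \<Longrightarrow> v \<in> nonneg_vecs (gsize P x) \<Longrightarrow>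
      \<exists>t s'. exec no_oracle A (input x (gsize P x) v) t s' \<and> t \<le> poly p (input_size P x) \<and>
        (feasible P x \<noteq> {} \<longrightarrow> approx_minimizer (feasible P x) (\<lambda>S. \<Sum>e\<in>S. v e)
           (\<alpha> (gsize P x)) (out_set (gsize P x) s'))"
    unfolding poly_time_min_sum_approx_def by blast
  \<comment> \<open>\<open>K\<close> is read off the text of \<open>A\<close>, so the resulting
    program is the same for all instances, values and norms.\<close>
  let ?K = "com_bound A"
  have "\<exists>t s'. exec (value_oracle (gsize P x) f) (minnorm_prog ?K A) (input x (gsize P x) v) t s' \<and>
      t \<le> poly (minnorm_time_poly ?K p) (input_size P x) \<and>
      (feasible P x \<noteq> {} \<longrightarrow> approx_minimizer (feasible P x) (\<lambda>S. f (restrict_vec v S))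
        (4 * \<alpha> (gsize P x) * real_of_int \<lceil>log 2 (real (gsize P x))\<rceil> + \<epsilon>)
        (out_set (gsize P x) s'))"
    if x: "x \<in> instances P" and v: "v \<in> nonneg_vecs (gsize P x)"
      and f: "symmetric_norm (gsize P x) f" "monotone_norm (gsize P x) f" for x v f
  proof -
    define n where "n = gsize P x"
    define F where "F = feasible P x"
    define m where "m = nat \<lceil>log 2 (real n)\<rceil>"
    \<comment> \<open>For \<open>n = 1\<close> the logarithm would vanish; here it is positive,
      which gives \<open>1 \<le> m\<close>.\<close>
    have n: "2 \<le> n" using assms(2) x by (simp add: n_def)
    have "0 < log 2 (real n)" using n by simp
    then have m_eq: "real m = real_of_int \<lceil>log 2 (real n)\<rceil>" and m1: "1 \<le> m"
      unfolding m_def by linarith+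
    have m: "2 ^ i < 2 * n \<longleftrightarrow> i \<le> m" for i
    proof -
      have "2 ^ i < 2 * n \<longleftrightarrow> (2::real) ^ i < 2 * real n"
        by (metis of_nat_less_iff of_nat_mult of_nat_numeral of_nat_power)
      also have "\<dots> \<longleftrightarrow> real i < log 2 (2 * real n)"
        using n by (simp add: less_log_iff powr_realpow)
      also have "log 2 (2 * real n) = 1 + log 2 (real n)"
        using n by (simp add: log_mult)
      \<comment> \<open>An integer is strictly below a real number exactly when it is strictly below
        its ceiling.\<close>
      also have "real i < 1 + log 2 (real n) \<longleftrightarrow> int i - 1 < \<lceil>log 2 (real n)\<rceil>"
        unfolding less_ceiling_iff by auto
      also have "\<dots> \<longleftrightarrow> i \<le> m" using m1 unfolding m_def by linarith
      finally show ?thesis .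
    qed
    have F: "F \<subseteq> Pow {..<n}" using assms(1) x by (auto simp: comb_problem_def F_def n_def)
    interpret minnorm_run n f ?K A x v m F "\<alpha> n" "poly p (input_size P x)"
    proof
      show "oracle_free A" using A by (simp add: poly_time_min_sum_approx_def)
    qed (use f v F m p[OF x] in \<open>simp_all add: n_def F_def\<close>)
    obtain t s' where t: "exec (value_oracle n f) (minnorm_prog ?K A) (input x n v) t s'"
      "t \<le> total_time"
      and s': "F \<noteq> {} \<Longrightarrow> out_set n s' \<in> F \<and> (\<forall>e\<le>n. \<forall>i\<le>m. \<exists>S.
        approx_minimizer F (\<lambda>S. \<Sum>e'\<in>S. weight v m (v e * phi (2 ^ i)) e') (\<alpha> n) S
        \<and> f (restrict_vec v (out_set n s')) \<le> f (restrict_vec v S))"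
      using runs_minnorm unfolding runs_def by blast
    have "total_time \<le> poly (minnorm_time_poly ?K p) (input_size P x)"
    proof -
      define z where "z = input_size P x"
      have le: "n \<le> z" "length x \<le> z" by (simp_all add: z_def input_size_def n_def)
      \<comment> \<open>The crude bound \<open>m < 2 ^ m < 2 * n\<close> makes \<open>m\<close>
        linear in the input size.\<close>
      have "m < 2 ^ m" by simp
      then have mz: "m \<le> 2 * z" using m[of m] le(1) by linarith
      have "n * (4 * m + 17) \<le> z * (8 * z + 17)" using le mz by (intro mult_mono) auto
      then have c: "cand_time + 2 \<le> 2 * ?K + 25 + 20 * z + 8 * z * z + poly p z"
        using le(2) by (simp add: cand_time_def z_def algebra_simps)
      have "Suc m * (cand_time + 2)
          \<le> (1 + 2 * z) * (2 * ?K + 25 + 20 * z + 8 * z * z + poly p z)"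
        using c mz by (intro mult_mono) auto
      then have "Suc n * (Suc m * (cand_time + 2) + 4)
          \<le> (1 + z) * ((1 + 2 * z) * (2 * ?K + 25 + 20 * z + 8 * z * z + poly p z) + 4)"
        using le by (intro mult_mono) auto
      moreover have "Suc m * (6 * n + 7) \<le> (1 + 2 * z) * (7 + 6 * z)"
        using le mz by (intro mult_mono) auto
      ultimately have "total_time \<le>
          (1 + z) * ((1 + 2 * z) * (2 * ?K + 25 + 20 * z + 8 * z * z + poly p z) + 4)
          + (1 + 2 * z) * (7 + 6 * z) + 3 * z + 6 * z + 14"
        unfolding total_time_def using le by linarith
      also have "\<dots> = poly (minnorm_time_poly ?K p) z"
        by (simp add: minnorm_time_poly_def algebra_simps)
      finally show ?thesis by (simp add: z_def)
    qed
    moreover have "approx_minimizer F (\<lambda>S. f (restrict_vec v S))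
        (4 * \<alpha> n * real_of_int \<lceil>log 2 (real n)\<rceil> + \<epsilon>) (out_set n s')" if ne: "F \<noteq> {}"
      unfolding approx_minimizer_def
    proof (intro conjI ballI)
      show "out_set n s' \<in> F" using s'[OF ne] by blast
      fix T assume T: "T \<in> F"
      \<comment> \<open>The loop test fails at \<open>Suc m\<close>, that is
        \<open>2 * n \<le> 2 * 2 ^ m\<close>.\<close>
      have "n \<le> 2 ^ m" using m[of "Suc m"] by simp
      \<comment> \<open>A good threshold is chosen for each competitor \<open>T\<close> separately,
        and the program has tried all of them.\<close>
      then obtain e i where ei: "e \<le> n" "i \<le> m"
        "\<And>S. approx_minimizer F (\<lambda>S. \<Sum>e'\<in>S. weight v m (v e * phi (2 ^ i)) e') (\<alpha> n) S \<Longrightarrow>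
          f (restrict_vec v S) \<le> 4 * \<alpha> n * m * f (restrict_vec v T)"
        using threshold_approx[of v m F "\<alpha> n" T] n v m1 F assms(4) T n_def by auto
      then have "f (restrict_vec v (out_set n s')) \<le> 4 * \<alpha> n * m * f (restrict_vec v T)"
        using s'[OF ne] by (meson order_trans)
      also have "\<dots> \<le> (4 * \<alpha> n * m + \<epsilon>) * f (restrict_vec v T)"
      proof -
        have "restrict_vec v T \<in> nonneg_vecs n"
          using T F v by (intro restrict_vec_nonneg) (auto simp: nonneg_vecs_def)
        then have "0 \<le> f (restrict_vec v T)" by (intro norm_nonneg nonneg_vecs_vecs)
        then show ?thesis using assms(6) by (intro mult_right_mono) auto
      qed
      finally show "f (restrict_vec v (out_set n s'))
          \<le> (4 * \<alpha> n * real_of_int \<lceil>log 2 (real n)\<rceil> + \<epsilon>) * f (restrict_vec v T)"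
        by (simp add: m_eq)
    qed
    ultimately show ?thesis using t unfolding n_def F_def by (blast intro: order_trans)
  qed
  then have "poly_time_min_norm_approx P
      (\<lambda>n. 4 * \<alpha> n * real_of_int \<lceil>log 2 (real n)\<rceil> + \<epsilon>) (minnorm_prog ?K A)"
    unfolding poly_time_min_norm_approx_def by (intro exI[of _ "minnorm_time_poly ?K p"]) blast
  then show ?thesis by blast
qed

end
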